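(* Let $n$ and $r$ be positive integers, let $t_1,\ldots,t_r$ be positive integers and put $\tau=t_1t_2\cdots t_r$. Suppose $\mathcal{C}\subseteq\mathcal{C}(\mathbb{R}^n,r)$ is a (measurable) family of $r$-chains in $\mathrm{Mod}(n)$ such that $\mathcal{C}_k$ is $t_k$-chain free for each $k\in\{1,\ldots,r\}$. Then $$\sum_{a_1+\cdots+a_{r+1}=n}\frac{\mu^n_{a_1,\ldots,a_r}(\mathcal{C}_{a_1,\ldots,a_r})}{\genfrac{[}{]}{0pt}{}{n}{a_1,\ldots,a_{r+1}}_{\mathbb{R}}}\le\tau,$$ where the sum is over all $(r+1)$-tuples of positive integers $(a_1,\ldots,a_{r+1})$ with $a_1+\cdots+a_{r+1}=n$. Consequently, $$\mu_{n;r}(\mathcal{C})\le m_1+\cdots+m_\tau,$$ where $m_1,\ldots,m_\tau$ are the $\tau$ largest multiflag coefficients $\genfrac{[}{]}{0pt}{}{n}{a_1,\ldots,a_{r+1}}_{\mathbb{R}}$ for positive integers $a_1,\ldots,a_{r+1}$ with $a_1+\cdots+a_{r+1}=n$.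
   Context: $\mathrm{Mod}(n)$ is the lattice of all linear subspaces of $\mathbb{R}^n$ ordered by inclusion. A chain of length $t$ is a collection of $t+1$ (distinct) subspaces that are pairwise comparable under inclusion; a family $\mathcal{A}\subseteq\mathrm{Mod}(n)$ is $t$-chain free if it contains no chain of length $t$. $r$-chains. An $r$-chain of $\mathrm{Mod}(n)$ is an $r$-tuple $(C_1,\ldots,C_r)$ of nonzero subspaces of $\mathbb{R}^n$ with $C_1\subsetneq\cdots\subsetneq C_r$. $\mathcal{C}(\mathbb{R}^n,r)$ is the set of all $r$-chains, and for positive integers $a_1,\ldots,a_r$ with $a_1+\cdots+a_r<n$, $\mathcal{C}(\mathbb{R}^n,r)_{a_1,\ldots,a_r}$ is the set of those with $\dim(C_i)=a_1+\cdots+a_i$ for all $i=1,\ldots,r$. For $\mathcal{C}\subseteq\mathcal{C}(\mathbb{R}^n,r)$: $\mathcal{C}_k=\{C_k\mid(C_1,\ldots,C_k,\ldots,C_r)\in\mathcal{C}\}$ and $\mathcal{C}_{a_1,\ldots,a_r}=\mathcal{C}\cap\mathcal{C}(\mathbb{R}^n,r)_{a_1,\ldots,a_r}$. Flags. $\mathrm{Flag}(n)$ is the compact manifold of complete flags $F=(F_0,\ldots,F_n)$, $F_0\subseteq F_1\subseteq\cdots\subseteq F_n$, $\dim F_k=k$, in $\mathbb{R}^n$. Let $\omega_m$ be the volume of the unit ball in $\mathbb{R}^m$ ($\omega_0=1$), $[m]_{\mathbb{R}}=\frac{m\omega_m}{2\omega_{m-1}}$ and $[m]_{\mathbb{R}}!=[m]_{\mathbb{R}}[m-1]_{\mathbb{R}}\cdots[1]_{\mathbb{R}}=\frac{m!\,\omega_m}{2^m}$.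 $\phi_n$ is the unique $O(n)$-invariant (completed Borel) measure on $\mathrm{Flag}(n)$ with total mass $[n]_{\mathbb{R}}!$. Measures. A flag $F$ is compatible with $(C_1,\ldots,C_r)\in\mathcal{C}(\mathbb{R}^n,r)_{a_1,\ldots,a_r}$ if $F_{a_1+\cdots+a_i}=C_i$ for all $i\in\{1,\ldots,r\}$. For $\mathcal{E}\subseteq\mathcal{C}(\mathbb{R}^n,r)_{a_1,\ldots,a_r}$, $\mathrm{Flag}(\mathcal{E})$ is the set of all flags compatible with some member of $\mathcal{E}$; $\mathcal{E}$ is measurable if $\mathrm{Flag}(\mathcal{E})$ is $\phi_n$-measurable, and then, with $a_{r+1}=n-\sum_{i=1}^ra_i$, $$\mu^n_{a_1,\ldots,a_r}(\mathcal{E})=\frac{1}{[a_1]_{\mathbb{R}}!\cdots[a_r]_{\mathbb{R}}!\,[a_{r+1}]_{\mathbb{R}}!}\,\phi_n(\mathrm{Flag}(\mathcal{E})).$$ The total measure of $\mathcal{C}(\mathbb{R}^n,r)_{a_1,\ldots,a_r}$ is the multiflag coefficient $\genfrac{[}{]}{0pt}{}{n}{a_1,\ldots,a_{r+1}}_{\mathbb{R}}=\frac{[n]_{\mathbb{R}}!}{[a_1]_{\mathbb{R}}!\cdots[a_{r+1}]_{\mathbb{R}}!}$. A family $\mathcal{C}\subseteq\mathcal{C}(\mathbb{R}^n,r)$ is measurable if every $\mathcal{C}_{a_1,\ldots,a_r}$ is, and then $\mu_{n;r}(\mathcal{C})=\sum_{a_1+\cdots+a_{r+1}=n}\mu^n_{a_1,\ldots,a_r}(\mathcal{C}_{a_1,\ldots,a_r})$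 (sum over positive integers $a_1,\ldots,a_{r+1}$). The "$\tau$ largest" coefficients are taken from the list of values indexed by all tuples $(a_1,\ldots,a_{r+1})$ of positive integers with sum $n$, i.e. counted with multiplicity; if $\tau$ exceeds the number of such tuples, the missing $m_i$ are set to $0$. *)

theory Defs
  imports "HOL-Analysis.Analysis"
begin

text \<open>The ambient space is \<^typ>\<open>real ^ 'n\<close> with n = \<^term>\<open>CARD('n)\<close>; Mod(n) is the set of all
  \<^term>\<open>S :: (real ^ 'n) set\<close> with \<^term>\<open>subspace S\<close>.\<close>

subsection \<open>Multiflag coefficients\<close>

definition rbracket :: "nat \<Rightarrow> real" where
  "rbracket m = real m * unit_ball_vol (real m) / (2 * unit_ball_vol (real (m - 1)))"

definition rfact :: "nat \<Rightarrow> real" where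
  "rfact m = (\<Prod>i=1..m. rbracket i)"

text \<open>The argument is the full lower index (a_1, ..., a_{r+1}); the upper index is its sum.\<close>

definition multiflag_coeff :: "nat list \<Rightarrow> real" where
  "multiflag_coeff a = rfact (sum_list a) / (\<Prod>x\<leftarrow>a. rfact x)"

definition compositions :: "nat \<Rightarrow> nat \<Rightarrow> nat list set" where
  "compositions n k = {a. length a = k \<and> (\<forall>x\<in>set a. 0 < x) \<and> sum_list a = n}"

text \<open>The \<open>\<tau>\<close> largest multiflag coefficients with k positive lower indices summing to n, in decreasing order
  and with multiplicity; the list is shorter than \<open>\<tau>\<close> if there are fewer than \<open>\<tau>\<close> compositions.\<close>

definition largest_coeffs :: "nat \<Rightarrow> nat \<Rightarrow> nat \<Rightarrow> real list" where
  "largest_coeffs \<tau> n k =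
     take \<tau> (rev (sorted_list_of_multiset
       (image_mset multiflag_coeff (mset_set (compositions n k)))))"

subsection \<open>Chains\<close>

definition chain_free :: "nat \<Rightarrow> 'a set set \<Rightarrow> bool" where
  "chain_free t \<A> \<longleftrightarrow> \<not> (\<exists>K\<subseteq>\<A>. card K = t + 1 \<and> (\<forall>U\<in>K. \<forall>V\<in>K. U \<subseteq> V \<or> V \<subseteq> U))"

text \<open>An r-chain (C_1, ..., C_r) is a list of length r, with C_i at position i - 1.\<close>

definition rchains :: "nat \<Rightarrow> (real ^ 'n) set list set" where
  "rchains r = {cs. length cs = r \<and> (\<forall>U\<in>set cs. subspace U \<and> U \<noteq> {0}) \<and> sorted_wrt (\<subset>) cs}"

definition component :: "nat \<Rightarrow> 'a list set \<Rightarrow> 'a set" where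
  "component k \<C> = (\<lambda>cs. cs ! (k - 1)) ` \<C>"

definition index_tuples :: "nat \<Rightarrow> nat \<Rightarrow> nat list set" where
  "index_tuples n r = {as. length as = r \<and> (\<forall>x\<in>set as. 0 < x) \<and> sum_list as < n}"

text \<open>The members of \<open>\<C>\<close> with dim C_i = a_1 + ... + a_i for i = 1, ..., r.\<close>

definition of_type :: "(real ^ 'n) set list set \<Rightarrow> nat list \<Rightarrow> (real ^ 'n) set list set" where
  "of_type \<C> as = {cs\<in>\<C>. length cs = length as \<and>
     (\<forall>i\<in>{1..length as}. dim (cs ! (i - 1)) = sum_list (take i as))}"

subsection \<open>Complete flags and the invariant measure\<close>

text \<open>A flag (F_0, ..., F_n) is a function on the naturals; being extensional, it takes a fixed
  irrelevant value at indices above n.\<close>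

definition flags :: "(nat \<Rightarrow> (real ^ 'n) set) set" where
  "flags = {F \<in> extensional {..CARD('n)}.
     (\<forall>k\<le>CARD('n). subspace (F k) \<and> dim (F k) = k) \<and> (\<forall>k<CARD('n). F k \<subseteq> F (Suc k))}"

text \<open>The manifold topology on Flag(n), obtained by embedding a flag as the sequence of the matrices
  of the orthogonal projections onto its members; \<^term>\<open>closest_point S\<close> is the orthogonal
  projection onto S if S is a subspace. The matrices at indices above n are the same for all flags.\<close>

definition flag_topology :: "(nat \<Rightarrow> (real ^ 'n) set) topology" where
  "flag_topology = pullback_topology flags
     (\<lambda>F k. matrix (closest_point (F k)) :: real ^ 'n ^ 'n) euclidean"

definition flag_action ::
    "(real ^ 'n \<Rightarrow> real ^ 'n) \<Rightarrow> (nat \<Rightarrow> (real ^ 'n) set) \<Rightarrow> (nat \<Rightarrow> (real ^ 'n) set)" where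
  "flag_action g F = (\<lambda>k\<in>{..CARD('n)}. g ` F k)"

definition is_invariant_flag_measure :: "(nat \<Rightarrow> (real ^ 'n) set) measure \<Rightarrow> bool" where
  "is_invariant_flag_measure M \<longleftrightarrow>
     space M = flags \<and>
     sets M = sigma_sets flags {U. openin flag_topology U} \<and>
     (\<forall>g. orthogonal_transformation g \<longrightarrow>
        (\<forall>E\<in>sets M. emeasure M (flag_action g ` E) = emeasure M E)) \<and>
     emeasure M flags = ennreal (rfact CARD('n))"

definition flag_measure :: "(nat \<Rightarrow> (real ^ 'n) set) measure" where
  "flag_measure = completion (THE M. is_invariant_flag_measure M)"

subsection \<open>Measures on chains\<close>

definition compatible :: "nat list \<Rightarrow> (nat \<Rightarrow> 'a set) \<Rightarrow> 'a set list \<Rightarrow> bool" where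
  "compatible as F cs \<longleftrightarrow> (\<forall>i\<in>{1..length as}. F (sum_list (take i as)) = cs ! (i - 1))"

definition flags_through ::
    "nat list \<Rightarrow> (real ^ 'n) set list set \<Rightarrow> (nat \<Rightarrow> (real ^ 'n) set) set" where
  "flags_through as \<E> = {F\<in>flags. \<exists>cs\<in>\<E>. compatible as F cs}"

text \<open>Here \<open>as\<close> is (a_1, ..., a_r), and a_{r+1} is the remainder n - (a_1 + ... + a_r).\<close>

definition chain_measure :: "nat list \<Rightarrow> (real ^ 'n) set list set \<Rightarrow> real" where
  "chain_measure as \<E> = measure flag_measure (flags_through as \<E>) /
     ((\<Prod>x\<leftarrow>as. rfact x) * rfact (CARD('n) - sum_list as))"

definition measurable_family :: "nat \<Rightarrow> (real ^ 'n) set list set \<Rightarrow> bool" where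
  "measurable_family r \<C> \<longleftrightarrow>
     (\<forall>as\<in>index_tuples CARD('n) r. flags_through as (of_type \<C> as) \<in> sets flag_measure)"

text \<open>The sum ranges over (a_1, ..., a_{r+1}), and \<^term>\<open>butlast a\<close> is (a_1, ..., a_r).\<close>

definition family_measure :: "nat \<Rightarrow> (real ^ 'n) set list set \<Rightarrow> real" where
  "family_measure r \<C> = (\<Sum>a\<in>compositions CARD('n) (r + 1).
     chain_measure (butlast a) (of_type \<C> (butlast a)))"

end

(* With respect to the normalised flag measure, the sum is the expected number of compositions a such
   that a random complete flag F passes through a chain of type a in the family. For each F this number is at
   most tau: the members of F lying in the k-th component of the family form a chain, so there are at most
   t_k of them, and a is determined by the positions of the r chosen members. The second bound is then linear
   optimisation with weights in [0, 1] of total mass at most tau.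

   What remains is that the invariant measure exists and is unique. It is the image of Lebesgue measure on
   a ball of invertible matrices A under A |-> A F0. Any two such measures agree by
   Christensen's theorem on uniformly distributed measures, since O(n) acts transitively and isometrically on
   flags. The same theorem gives the invariance of Lebesgue measure under orthogonal transformations. *)
theory Submission
  imports Defs
begin

subsection \<open>Uniformly distributed measures\<close>

text \<open>The flag measure is given by a definite description, so not even its total mass is
  available until exactly one invariant measure is known to exist; this is why existence and
  uniqueness fill most of the proof. Lebesgue measure on the matrices stands in for Haar measure on
  O(n): left multiplication by an orthogonal matrix is an isometry of the Frobenius norm. Singular
  matrices are excluded because they do not carry flags to flags, and the ball keeps the mass
  finite. Describing a subspace by its orthogonal projection serves twice: it gives the topology,
  hence measurability by explicit formulas, and since orthogonal maps merely conjugate projections,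
  it also gives an O(n)-invariant distance. Christensen's theorem is phrased for a symmetric
  function \<open>D\<close> on the space of a measure, so that it covers both a Euclidean space and
  the set of flags, which is not a type.\<close>

lemma uniformly_distributed_le:
  fixes D :: "'a \<Rightarrow> 'a \<Rightarrow> real" and h :: "real \<Rightarrow> ennreal"
  assumes "sigma_finite_measure M" "sigma_finite_measure N"
    and sets: "sets N = sets M"
    and D[measurable]: "(\<lambda>p. D (fst p) (snd p)) \<in> borel_measurable (M \<Otimes>\<^sub>M M)"
    and sym: "\<And>x y. x \<in> space M \<Longrightarrow> y \<in> space M \<Longrightarrow> D x y = D y x"
    and ballM: "\<And>x r. x \<in> space M \<Longrightarrow> 0 < r \<Longrightarrow> emeasure M {y \<in> space M. D x y < r} = h r"
    and ballN: "\<And>x r. x \<in> space M \<Longrightarrow> 0 < r \<Longrightarrow> emeasure N {y \<in> space M. D x y < r} = h r"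
    and h: "\<And>r. 0 < r \<Longrightarrow> 0 < h r \<and> h r < \<infinity>"
    and U: "U \<in> sets M" "\<And>x. x \<in> U \<Longrightarrow> \<exists>r>0. {y \<in> space M. D x y < r} \<subseteq> U"
  shows "emeasure M U \<le> emeasure N U"
proof -
  interpret M: sigma_finite_measure M by fact
  interpret N: sigma_finite_measure N by fact
  interpret MN: pair_sigma_finite M N ..
  have space: "space N = space M"
    using sets by (rule sets_eq_imp_space_eq)
  have setsP: "sets (M \<Otimes>\<^sub>M N) = sets (M \<Otimes>\<^sub>M M)"
    by (intro sets_pair_measure_cong refl sets)
  have D'[measurable]: "(\<lambda>p. D (fst p) (snd p)) \<in> borel_measurable (M \<Otimes>\<^sub>M N)"
    using D measurable_cong_sets[OF setsP refl] by blast
  have Dx[measurable]: "D x \<in> borel_measurable M" if "x \<in> space M" for x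
    using measurable_compose[OF measurable_Pair1'[OF that] D] by simp
  have U'[measurable]: "U \<in> sets N"
    using U sets by simp
  note U(1)[measurable]
  define k where "k n = 1 / real (Suc n)" for n
  have k: "0 < k n" for n by (simp add: k_def)
  \<comment> \<open>Positivity and finiteness of \<open>h\<close> both matter: in
    \<open>ennreal\<close> the quotients 0/0 and \<infinity>/\<infinity> are 0.\<close>
  have hk: "h (k n) / h (k n) = 1" for n
    using h[OF k[of n]] by (intro ennreal_divide_self) (auto simp: less_top)
  define f where "f n p = indicator {p \<in> space (M \<Otimes>\<^sub>M N). snd p \<in> U \<and> D (fst p) (snd p) < k n} p / h (k n)"
    for n and p :: "'a \<times> 'a"
  have f[measurable]: "f n \<in> borel_measurable (M \<Otimes>\<^sub>M N)" for n
  proof -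
    have "{p \<in> space (M \<Otimes>\<^sub>M N). snd p \<in> U \<and> D (fst p) (snd p) < k n} \<in> sets (M \<Otimes>\<^sub>M N)"
      by measurable
    then show ?thesis
      unfolding f_def by measurable
  qed
  text \<open>Christensen's argument: u n x is N (U \<inter> B(x, k n)) / h (k n), which equals 1 for large n if x lies
    in U, while its M-integral is N U by Fubini; Fatou's lemma then compares M U with N U.\<close>
  define u where "u n x = (\<integral>\<^sup>+ y. f n (x, y) \<partial>N)" for n x
  have u[measurable]: "u n \<in> borel_measurable M" for n
    unfolding u_def by measurable
  have near: "indicator U x \<le> liminf (\<lambda>n. u n x)" for x
  proof (cases "x \<in> U")
    case True
    then have x: "x \<in> space M"
      using sets.sets_into_space[OF U(1)] by auto
    obtain r where r: "r > 0" "{y \<in> space M. D x y < r} \<subseteq> U"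
      using U(2) True by blast
    obtain n0 where n0: "k n0 < r"
      using nat_approx_posE[OF r(1)] unfolding k_def by (metis)
    have "1 \<le> u n x" if "n \<ge> n0" for n
    proof -
      have "k n \<le> k n0"
        using that by (simp add: k_def frac_le)
      then have sub: "{y \<in> space M. D x y < k n} \<subseteq> U"
        using r n0 by auto
      have "u n x = (\<integral>\<^sup>+ y. indicator {y \<in> space M. D x y < k n} y / h (k n) \<partial>N)"
        unfolding u_def
        by (rule nn_integral_cong)
           (use sub x space in \<open>auto simp: f_def indicator_def space_pair_measure\<close>)
      also have "\<dots> = emeasure N {y \<in> space M. D x y < k n} / h (k n)"
        using Dx[OF x] sets
        by (subst nn_integral_divide) (auto simp: nn_integral_indicator)
      also have "\<dots> = 1"
        using ballN[OF x k] hk by simp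
      finally show ?thesis by simp
    qed
    then have "1 \<le> liminf (\<lambda>n. u n x)"
      by (intro Liminf_bounded) (auto simp: eventually_sequentially)
    then show ?thesis using True by simp
  qed simp
  have "(\<integral>\<^sup>+ x. u n x \<partial>M) = emeasure N U" for n
  proof -
    have "(\<integral>\<^sup>+ x. u n x \<partial>M) = (\<integral>\<^sup>+ y. \<integral>\<^sup>+ x. f n (x, y) \<partial>M \<partial>N)"
      unfolding u_def by (rule MN.Fubini[symmetric]) measurable
    also have "\<dots> = (\<integral>\<^sup>+ y. indicator U y \<partial>N)"
    proof (rule nn_integral_cong)
      fix y assume y: "y \<in> space N"
      have "(\<integral>\<^sup>+ x. f n (x, y) \<partial>M) = (\<integral>\<^sup>+ x. indicator U y * (indicator {x \<in> space M. D y x < k n} x / h (k n)) \<partial>M)"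
        by (rule nn_integral_cong)
           (use y space sym in \<open>auto simp: f_def indicator_def space_pair_measure\<close>)
      also have "\<dots> = indicator U y * (emeasure M {x \<in> space M. D y x < k n} / h (k n))"
        using Dx[of y] y space
        by (subst nn_integral_cmult; (subst nn_integral_divide)?) (auto simp: nn_integral_indicator)
      also have "\<dots> = indicator U y"
        using ballM[of y, OF _ k] hk y space by simp
      finally show "(\<integral>\<^sup>+ x. f n (x, y) \<partial>M) = indicator U y" .
    qed
    finally show ?thesis
      by simp
  qed
  moreover have "emeasure M U \<le> (\<integral>\<^sup>+ x. liminf (\<lambda>n. u n x) \<partial>M)"
    using nn_integral_mono[of M "indicator U", OF near] U(1) by simp
  moreover have "\<dots> \<le> liminf (\<lambda>n. integral\<^sup>N M (u n))"
    by (rule nn_integral_liminf) measurable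
  ultimately show ?thesis
    by (simp add: Liminf_const)
qed

text \<open>The hypotheses are symmetric in the two measures, so the comparison on
  \<open>D\<close>-open sets holds in both directions. A pi-system of such sets then determines the
  measure, with \<open>A\<close> as the finite exhaustion that this argument requires.\<close>

lemma uniformly_distributed_unique:
  fixes D :: "'a \<Rightarrow> 'a \<Rightarrow> real" and h :: "real \<Rightarrow> ennreal"
  assumes "sigma_finite_measure M" "sigma_finite_measure N"
    and "(\<lambda>p. D (fst p) (snd p)) \<in> borel_measurable (M \<Otimes>\<^sub>M M)"
    and "\<And>x y. x \<in> space M \<Longrightarrow> y \<in> space M \<Longrightarrow> D x y = D y x"
    and "\<And>x r. x \<in> space M \<Longrightarrow> 0 < r \<Longrightarrow> emeasure M {y \<in> space M. D x y < r} = h r"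
    and "\<And>x r. x \<in> space M \<Longrightarrow> 0 < r \<Longrightarrow> emeasure N {y \<in> space M. D x y < r} = h r"
    and "\<And>r. 0 < r \<Longrightarrow> 0 < h r \<and> h r < \<infinity>"
    and E: "Int_stable E" "E \<subseteq> Pow \<Omega>" "sets M = sigma_sets \<Omega> E" "sets N = sigma_sets \<Omega> E"
    and U: "\<And>U x. U \<in> E \<Longrightarrow> x \<in> U \<Longrightarrow> \<exists>r>0. {y \<in> space M. D x y < r} \<subseteq> U"
    and A: "range A \<subseteq> E" "(\<Union>i::nat. A i) = \<Omega>" "\<And>i. emeasure M (A i) \<noteq> \<infinity>"
  shows "M = N"
proof (rule measure_eqI_generator_eq[OF E(1,2) _ E(3,4) A])
  fix X assume X: "X \<in> E"
  have sets: "sets N = sets M"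
    using E by simp
  have space: "space N = space M"
    using sets by (rule sets_eq_imp_space_eq)
  have D: "(\<lambda>p. D (fst p) (snd p)) \<in> borel_measurable (N \<Otimes>\<^sub>M N)"
    using assms(3) measurable_cong_sets[OF sets_pair_measure_cong[OF sets sets] refl] by blast
  have XM: "X \<in> sets M"
    using X E(3) by auto
  show "emeasure M X = emeasure N X"
  proof (rule antisym)
    show "emeasure M X \<le> emeasure N X"
      using uniformly_distributed_le[OF assms(1,2) sets assms(3-7) XM U[OF X]] .
    show "emeasure N X \<le> emeasure M X"
      by (rule uniformly_distributed_le[OF assms(2,1) sets[symmetric] D, of h])
         (use assms(4-7) XM U[OF X] in \<open>auto simp: space sets\<close>)
  qed
qed

text \<open>The preimage of a ball under a surjective isometry is a ball of the same radius, so both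
  measures give each ball of radius r the mass of a Euclidean ball.\<close>

lemma lborel_distr_orthogonal_transformation:
  fixes L :: "'a::euclidean_space \<Rightarrow> 'a"
  assumes L: "orthogonal_transformation L"
  shows "distr lborel borel L = lborel"
proof (rule sym, rule uniformly_distributed_unique[where D = dist and E = "{S. open S}" and \<Omega> = UNIV
      and A = "\<lambda>n. ball 0 (real n)"
      and h = "\<lambda>r. ennreal (unit_ball_vol (DIM('a)) * r ^ DIM('a))"])
  have [measurable]: "L \<in> borel_measurable borel"
    using L by (intro borel_measurable_continuous_onI linear_continuous_on)
      (simp add: linear_linear orthogonal_transformation_linear)
  have vim: "L -` ball (L x) r = ball x r" for x r
    using L by (auto simp: orthogonal_transformation_isometry)
  have surj: "\<exists>y. x = L y" for x
    using L orthogonal_transformation_surj by (metis surj_def)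
  have ball: "emeasure (distr lborel borel L) (ball x r) = ennreal (unit_ball_vol (DIM('a)) * r ^ DIM('a))"
    if "r > 0" for x r
  proof -
    obtain y where "x = L y" using surj by blast
    then show ?thesis
      using that by (subst emeasure_distr) (auto simp: vim emeasure_ball)
  qed
  show "sigma_finite_measure lborel"
    by (rule lborel.sigma_finite_measure_axioms)
  show "sigma_finite_measure (distr lborel borel L)"
  proof
    show "\<exists>A. countable A \<and> A \<subseteq> sets (distr lborel borel L) \<and> \<Union> A = space (distr lborel borel L) \<and>
        (\<forall>a\<in>A. emeasure (distr lborel borel L) a \<noteq> \<infinity>)"
    proof (intro exI conjI ballI)
      \<comment> \<open>The radii start at 1 because the mass formula \<open>ball\<close> is
        available for positive radii only.\<close>
      show "\<Union> (range (\<lambda>n. ball (0::'a) (real (Suc n)))) = space (distr lborel borel L)"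
      proof -
        have "\<exists>n. norm x < real (Suc n)" for x :: 'a
          using reals_Archimedean2[of "norm x"] by (meson less_trans of_nat_less_iff lessI)
        then show ?thesis by auto
      qed
    qed (auto simp: ball simp del: of_nat_Suc)
  qed
  show "emeasure lborel {y \<in> space lborel. dist x y < r} = ennreal (unit_ball_vol (DIM('a)) * r ^ DIM('a))"
    "emeasure (distr lborel borel L) {y \<in> space lborel. dist x y < r} = ennreal (unit_ball_vol (DIM('a)) * r ^ DIM('a))"
    if "r > 0" for x r
    using that ball[OF that, of x] emeasure_ball[of r x] by (simp_all add: ball_def)
  show "Int_stable {S::'a set. open S}"
    by (auto simp: Int_stable_def)
  show "\<exists>r>0. {y \<in> space lborel. dist x y < r} \<subseteq> U" if "U \<in> {S. open S}" "x \<in> U" for U and x :: 'a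
    using that by (auto simp: open_contains_ball ball_def)
  show "(\<Union>i. ball (0::'a) (real i)) = UNIV"
    using reals_Archimedean2 by auto
  show "emeasure lborel (ball (0::'a) (real i)) \<noteq> \<infinity>" for i
    using emeasure_lborel_ball_finite[of "0::'a" "real i"] by simp
  show "sets lborel = sigma_sets UNIV {S::'a set. open S}"
    "sets (distr lborel borel L) = sigma_sets UNIV {S. open S}"
    by (simp_all add: borel_def)
qed (auto simp: dist_commute)

subsection \<open>Orthogonal projections onto subspaces\<close>

text \<open>By Pythagoras, replacing \<open>y\<close> by another point of \<open>S\<close> adds a
  square to the squared distance. With this criterion, identities between projections become checks
  of inner products.\<close>

lemma closest_point_subspace_eqI:
  fixes S :: "'a::euclidean_space set"
  assumes S: "subspace S" and y: "y \<in> S" and orth: "\<And>w. w \<in> S \<Longrightarrow> (x - y) \<bullet> w = 0"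
  shows "closest_point S x = y"
proof (rule closest_point_unique[symmetric])
  show "convex S" "closed S"
    using S by (auto simp: subspace_imp_convex closed_subspace)
  show "\<forall>z\<in>S. dist x y \<le> dist x z"
  proof
    fix z assume z: "z \<in> S"
    have "(norm (x - z))\<^sup>2 = (norm ((x - y) + (y - z)))\<^sup>2" by simp
    also have "\<dots> = (norm (x - y))\<^sup>2 + (norm (y - z))\<^sup>2"
      using orth[OF subspace_diff[OF S y z]] by (intro norm_add_Pythagorean) (simp add: orthogonal_def)
    finally have "(norm (x - y))\<^sup>2 \<le> (norm (x - z))\<^sup>2" by simp
    then show "dist x y \<le> dist x z"
      by (simp add: dist_norm power2_le_iff_abs_le)
  qed
qed fact

lemma
  fixes S :: "'a::euclidean_space set"
  assumes S: "subspace S"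
  shows closest_point_subspace_in: "closest_point S x \<in> S"
    and closest_point_subspace_orthogonal: "w \<in> S \<Longrightarrow> (x - closest_point S x) \<bullet> w = 0"
proof -
  obtain y z where yz: "y \<in> span S" "\<And>w. w \<in> span S \<Longrightarrow> orthogonal z w" "x = y + z"
    using orthogonal_subspace_decomp_exists by blast
  have *: "span S = S" using S by (simp add: span_eq_iff)
  have eq: "closest_point S x = y"
    using yz S unfolding * by (intro closest_point_subspace_eqI) (auto simp: orthogonal_def)
  show "closest_point S x \<in> S" "w \<in> S \<Longrightarrow> (x - closest_point S x) \<bullet> w = 0"
    using yz unfolding eq * by (auto simp: orthogonal_def)
qed

lemma linear_closest_point_subspace:
  fixes S :: "'a::euclidean_space set"
  assumes S: "subspace S"
  shows "linear (closest_point S)"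
proof (rule linearI)
  note orth = closest_point_subspace_orthogonal[OF S] and mem = closest_point_subspace_in[OF S]
  show "closest_point S (x + y) = closest_point S x + closest_point S y" for x y
  proof (rule closest_point_subspace_eqI[OF S])
    fix w assume "w \<in> S"
    then show "(x + y - (closest_point S x + closest_point S y)) \<bullet> w = 0"
      using orth[of w x] orth[of w y] by (simp add: inner_diff_left inner_add_left)
  qed (intro subspace_add S mem)
  show "closest_point S (c *\<^sub>R x) = c *\<^sub>R closest_point S x" for c x
  proof (rule closest_point_subspace_eqI[OF S])
    fix w assume "w \<in> S"
    then show "(c *\<^sub>R x - c *\<^sub>R closest_point S x) \<bullet> w = 0"
      using orth[of w x] by (simp add: inner_diff_left)
  qed (intro subspace_scale S mem)
qed

lemma closest_point_orthogonal_image: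
  fixes S :: "'a::euclidean_space set" and g :: "'a \<Rightarrow> 'a"
  assumes S: "subspace S" and g: "orthogonal_transformation g"
  shows "closest_point (g ` S) (g x) = g (closest_point S x)"
proof (rule closest_point_subspace_eqI)
  have lin: "linear g" using g by (rule orthogonal_transformation_linear)
  then show "subspace (g ` S)"
    using S by (rule linear_subspace_image)
  show "g (closest_point S x) \<in> g ` S"
    using closest_point_subspace_in[OF S] by simp
  fix w assume "w \<in> g ` S"
  then obtain v where "v \<in> S" "w = g v" by blast
  then show "(g x - g (closest_point S x)) \<bullet> w = 0"
    using closest_point_subspace_orthogonal[OF S, of v x] g
    by (simp add: linear_diff[OF lin, symmetric] orthogonal_transformation_def)
qed

text \<open>For w in S the increment u vanishes, and the division by zero gives the correct value.\<close>

lemma closest_point_span_insert: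
  fixes S :: "'a::euclidean_space set"
  assumes S: "subspace S" and u: "u = w - closest_point S w"
  shows "closest_point (span (insert w S)) x = closest_point S x + ((u \<bullet> x) / (u \<bullet> u)) *\<^sub>R u"
proof (rule closest_point_subspace_eqI[OF subspace_span])
  let ?P = "closest_point S"
  let ?c = "(u \<bullet> x) / (u \<bullet> u)"
  note mem = closest_point_subspace_in[OF S] and orth = closest_point_subspace_orthogonal[OF S]
  have "u \<in> span (insert w S)" unfolding u
    by (intro span_diff span_base) (auto simp: mem)
  then show "?P x + ?c *\<^sub>R u \<in> span (insert w S)"
    by (intro span_add span_scale) (auto intro: span_base mem)
  fix z assume z: "z \<in> span (insert w S)"
  have uS: "u \<bullet> y = 0" if "y \<in> S" for y
    using orth[OF that, of w] u by simp
  have onS: "(x - (?P x + ?c *\<^sub>R u)) \<bullet> y = 0" if "y \<in> S" for y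
    using orth[OF that, of x] uS[OF that] by (simp add: inner_diff_left inner_add_left)
  have w: "w = u + ?P w" using u by simp
  have "(x - (?P x + ?c *\<^sub>R u)) \<bullet> u = u \<bullet> x - ?P x \<bullet> u - ?c * (u \<bullet> u)"
    by (simp add: inner_diff_left inner_add_left inner_commute[of x u])
  also have "\<dots> = 0"
    using uS[OF mem, of x] by (simp add: inner_commute[of "?P x" u])
  finally have "(x - (?P x + ?c *\<^sub>R u)) \<bullet> w = 0"
    using onS[OF mem, of w] by (subst w) (simp add: inner_add_right)
  then have "orthogonal (x - (?P x + ?c *\<^sub>R u)) z"
    using onS by (intro orthogonal_to_span[OF z]) (auto simp: orthogonal_def)
  then show "(x - (?P x + ?c *\<^sub>R u)) \<bullet> z = 0"
    by (simp add: orthogonal_def)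
qed

section \<open>Orthogonal matrices, the Frobenius norm and reflections\<close>

lemma norm_transpose:
  fixes X :: "real ^ 'n ^ 'm"
  shows "norm (transpose X) = norm X"
proof -
  have "(norm (transpose X))\<^sup>2 = (norm X)\<^sup>2"
    by (simp add: power2_norm_eq_inner inner_vec_def transpose_def) (rule sum.swap)
  then show ?thesis by simp
qed

text \<open>The product applies \<open>G\<close> to each row of \<open>X\<close> separately, and the
  norm of a matrix is the Euclidean norm of the vector of its row norms.\<close>

lemma norm_mult_transpose_orthogonal:
  fixes X :: "real ^ 'n ^ 'm" and G :: "real ^ 'n ^ 'n"
  assumes "orthogonal_matrix G"
  shows "norm (X ** transpose G) = norm X"
proof -
  have "orthogonal_transformation ((*v) G)"
    using assms by (simp add: orthogonal_transformation_matrix)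
  then have G: "norm (G *v v) = norm v" for v
    by (rule orthogonal_transformation_norm)
  have "(X ** transpose G) $ i = G *v (X $ i)" for i
    by (simp add: vec_eq_iff matrix_matrix_mult_def matrix_vector_mult_def transpose_def mult.commute)
  then show ?thesis
    using G by (simp add: norm_vec_def)
qed

lemma norm_orthogonal_matrix_mult:
  fixes X :: "real ^ 'm ^ 'n" and G :: "real ^ 'n ^ 'n"
  assumes "orthogonal_matrix G"
  shows "norm (G ** X) = norm X"
  using norm_mult_transpose_orthogonal[OF assms, of "transpose X"]
  by (metis matrix_transpose_mul norm_transpose transpose_transpose)

lemma matrix_closest_point_orthogonal_image:
  fixes S :: "(real ^ 'n) set" and g :: "real ^ 'n \<Rightarrow> real ^ 'n"
  assumes g: "orthogonal_transformation g" and S: "subspace S"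
  shows "matrix (closest_point (g ` S)) = matrix g ** matrix (closest_point S) ** transpose (matrix g)"
proof -
  define G where "G = matrix g"
  have G: "orthogonal_matrix G" and lin: "linear g"
    using g by (simp_all add: G_def orthogonal_transformation_matrix)
  have gv: "g x = G *v x" for x
    using lin by (simp add: G_def)
  have "matrix (closest_point (g ` S)) *v x = (G ** matrix (closest_point S) ** transpose G) *v x" for x
  proof -
    have "G *v (transpose G *v x) = (G ** transpose G) *v x"
      by (rule matrix_vector_mul_assoc)
    then have "g (transpose G *v x) = x"
      using G unfolding gv by (simp only: orthogonal_matrix_def matrix_vector_mul_lid)
    then have "matrix (closest_point (g ` S)) *v x = g (closest_point S (transpose G *v x))"
      using closest_point_orthogonal_image[OF S g, of "transpose G *v x"]
        linear_closest_point_subspace[OF linear_subspace_image[OF lin S]]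
      by (simp add: matrix_works)
    also have "\<dots> = G *v (matrix (closest_point S) *v (transpose G *v x))"
      using linear_closest_point_subspace[OF S] by (simp add: gv matrix_works)
    finally show ?thesis
      by (simp only: matrix_vector_mul_assoc[symmetric])
  qed
  then show ?thesis by (simp add: matrix_eq G_def)
qed

text \<open>Both projections are conjugated by the same orthogonal matrix, and so is their
  difference; neither factor changes its Frobenius norm. This is the source of the invariant
  distance on flags.\<close>

lemma dist_matrix_closest_point_orthogonal_image:
  fixes S T :: "(real ^ 'n) set" and g :: "real ^ 'n \<Rightarrow> real ^ 'n"
  assumes g: "orthogonal_transformation g" and S: "subspace S" and T: "subspace T"
  shows "dist (matrix (closest_point (g ` S))) (matrix (closest_point (g ` T))) =
    dist (matrix (closest_point S)) (matrix (closest_point T))"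
proof -
  have G: "orthogonal_matrix (matrix g)"
    using g by (simp add: orthogonal_transformation_matrix)
  have "matrix (closest_point (g ` S)) - matrix (closest_point (g ` T)) =
      matrix g ** ((matrix (closest_point S) - matrix (closest_point T)) ** transpose (matrix g))"
    unfolding matrix_closest_point_orthogonal_image[OF g S] matrix_closest_point_orthogonal_image[OF g T] matrix_eq
    by (simp only: matrix_vector_mult_diff_rdistrib matrix_vector_mult_diff_distrib
        matrix_vector_mul_assoc[symmetric] simp_thms)
  then show ?thesis
    using G by (simp add: dist_norm norm_orthogonal_matrix_mult norm_mult_transpose_orthogonal)
qed

text \<open>The last property lets a partial match of two flags be corrected at the next level
  without disturbing the lower levels.\<close>

lemma orthogonal_transformation_reflection:
  fixes a b :: "'a::euclidean_space"
  assumes "norm a = norm b"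
  obtains g where "orthogonal_transformation g" "g a = b"
    "\<And>x. a \<bullet> x = 0 \<Longrightarrow> b \<bullet> x = 0 \<Longrightarrow> g x = x"
proof
  \<comment> \<open>\<open>g\<close> is the Householder reflection in the hyperplane orthogonal to
    \<open>v\<close>; for \<open>a = b\<close> division by zero makes it the identity.\<close>
  define v where "v = a - b"
  define g where "g x = x - (2 * (v \<bullet> x) / (v \<bullet> v)) *\<^sub>R v" for x
  have lin: "linear g"
    by (rule linearI) (auto simp: g_def inner_add_right algebra_simps add_divide_distrib)
  have "norm (g x) = norm x" for x
  proof (cases "v = 0")
    case False
    then have "g x \<bullet> g x = x \<bullet> x"
      by (simp add: g_def inner_diff_left inner_diff_right inner_commute field_simps)
    then show ?thesis by (simp add: norm_eq_sqrt_inner)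
  qed (simp add: g_def)
  then show "orthogonal_transformation g"
    using lin by (simp add: orthogonal_transformation)
  have ab: "a \<bullet> a = b \<bullet> b"
    using assms by (simp add: norm_eq)
  show "g a = b"
  proof (cases "v = 0")
    case False
    have "2 * (v \<bullet> a) = v \<bullet> v"
      by (simp add: v_def inner_diff_left inner_diff_right inner_commute ab)
    then show ?thesis using False by (simp add: g_def v_def)
  qed (simp add: g_def v_def)
  show "g x = x" if "a \<bullet> x = 0" "b \<bullet> x = 0" for x
    using that by (simp add: g_def v_def inner_diff_left)
qed

subsection \<open>The flag manifold\<close>

lemma
  assumes "F \<in> (flags :: (nat \<Rightarrow> (real ^ 'n) set) set)" "k \<le> CARD('n)"
  shows subspace_flag: "subspace (F k)" and dim_flag: "dim (F k) = k"
  using assms by (auto simp: flags_def)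

lemma flag_undefined:
  assumes "F \<in> (flags :: (nat \<Rightarrow> (real ^ 'n) set) set)" "\<not> k \<le> CARD('n)"
  shows "F k = undefined"
  using assms by (auto simp: flags_def extensional_def)

lemma flag_mono:
  assumes F: "F \<in> (flags :: (nat \<Rightarrow> (real ^ 'n) set) set)" and "j \<le> k" "k \<le> CARD('n)"
  shows "F j \<subseteq> F k"
  using assms(2,3)
proof (induction k rule: dec_induct)
  case (step k)
  then have "F k \<subseteq> F (Suc k)"
    using F by (auto simp: flags_def)
  with step show ?case by auto
qed simp

lemma flag_0:
  assumes F: "F \<in> (flags :: (nat \<Rightarrow> (real ^ 'n) set) set)"
  shows "F 0 = {0}"
  using dim_flag[OF F, of 0] subspace_0[OF subspace_flag[OF F, of 0]] by (auto simp: dim_eq_0)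

text \<open>\<open>F k\<close> has codimension 1 in \<open>F (Suc k)\<close>, so a unit vector of
  \<open>F (Suc k)\<close> orthogonal to \<open>F k\<close> completes it by a dimension
  count.\<close>

lemma flag_step:
  assumes F: "F \<in> (flags :: (nat \<Rightarrow> (real ^ 'n) set) set)" and k: "k < CARD('n)"
  obtains u where "norm u = 1" "\<And>x. x \<in> F k \<Longrightarrow> u \<bullet> x = 0" "F (Suc k) = span (insert u (F k))"
proof -
  have S: "subspace (F k)" "dim (F k) = k" "subspace (F (Suc k))" "dim (F (Suc k)) = Suc k" "F k \<subseteq> F (Suc k)"
    using subspace_flag[OF F] dim_flag[OF F] flag_mono[OF F, of k "Suc k"] k by auto
  then have sp: "span (F k) = F k" "span (F (Suc k)) = F (Suc k)"
    by (auto simp: span_eq_iff)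
  have "span (F k) \<subset> span (F (Suc k))"
    using S unfolding sp by (metis n_not_Suc_n psubsetI)
  then obtain v where v: "v \<noteq> 0" "v \<in> F (Suc k)" "\<And>x. x \<in> F k \<Longrightarrow> orthogonal v x"
    using orthogonal_to_subspace_exists_gen[of "F k" "F (Suc k)"] unfolding sp by metis
  define u where "u = v /\<^sub>R norm v"
  have u: "norm u = 1" "\<And>x. x \<in> F k \<Longrightarrow> u \<bullet> x = 0" "u \<in> F (Suc k)"
    using v S(3) by (auto simp: u_def orthogonal_def subspace_scale)
  have "u \<notin> F k"
    using u(1) u(2)[of u] by auto
  then have "dim (span (insert u (F k))) = Suc k"
    using S(2) by (simp add: dim_insert sp)
  moreover have "span (insert u (F k)) \<subseteq> F (Suc k)"
    using u S by (intro span_minimal) auto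
  ultimately have "F (Suc k) = span (insert u (F k))"
    using S by (metis order_refl subspace_dim_equal subspace_span)
  with u show ?thesis using that by blast
qed

lemma flags_nonempty: "(flags :: (nat \<Rightarrow> (real ^ 'n) set) set) \<noteq> {}"
proof -
  obtain bs where bs: "set bs = (Basis :: (real ^ 'n) set)" "distinct bs"
    using finite_distinct_list[OF finite_Basis] by blast
  have len: "length bs = CARD('n)"
    using distinct_card[OF bs(2)] bs(1) by simp
  define F where "F = (\<lambda>k\<in>{..CARD('n)}. span (set (take k bs)))"
  have "dim (F k) = k" if "k \<le> CARD('n)" for k
  proof -
    have "set (take k bs) \<subseteq> Basis"
      using bs set_take_subset by metis
    then have "dim (set (take k bs)) = card (set (take k bs))"
      by (intro dim_eq_card_independent independent_mono[OF independent_Basis])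
    also have "\<dots> = k"
      using bs(2) that len by (simp add: distinct_card)
    finally show ?thesis using that by (simp add: F_def)
  qed
  moreover have "F k \<subseteq> F (Suc k)" if "k < CARD('n)" for k
    using that by (simp add: F_def) (intro span_mono set_take_subset_set_take, simp)
  ultimately have "F \<in> flags"
    by (auto simp: flags_def F_def)
  then show ?thesis by blast
qed

text \<open>Induction on the level: if \<open>g\<close> matches the flags up to level k, then
  \<open>g u\<close> and \<open>u'\<close> are unit vectors orthogonal to \<open>F' k\<close>, so
  the reflection exchanging them fixes \<open>F' k\<close> pointwise and can be composed with
  \<open>g\<close>.\<close>

lemma flags_transitive:
  assumes F: "F \<in> (flags :: (nat \<Rightarrow> (real ^ 'n) set) set)" and F': "F' \<in> flags"
  obtains g where "orthogonal_transformation g" "flag_action g F = F'"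
proof -
  have "\<exists>g. orthogonal_transformation g \<and> (\<forall>j\<le>k. g ` F j = F' j)" if "k \<le> CARD('n)" for k
    using that
  proof (induction k)
    case 0
    show ?case
      by (rule exI[of _ "\<lambda>x. x"]) (simp add: flag_0[OF F] flag_0[OF F'])
  next
    case (Suc k)
    then obtain g where g: "orthogonal_transformation g" "\<And>j. j \<le> k \<Longrightarrow> g ` F j = F' j"
      by auto
    obtain u where u: "norm u = 1" "\<And>x. x \<in> F k \<Longrightarrow> u \<bullet> x = 0" "F (Suc k) = span (insert u (F k))"
      using flag_step[OF F, of k] Suc.prems by auto
    obtain u' where u': "norm u' = 1" "\<And>x. x \<in> F' k \<Longrightarrow> u' \<bullet> x = 0" "F' (Suc k) = span (insert u' (F' k))"
      using flag_step[OF F', of k] Suc.prems by auto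
    obtain h where h: "orthogonal_transformation h" "h (g u) = u'"
      "\<And>x. g u \<bullet> x = 0 \<Longrightarrow> u' \<bullet> x = 0 \<Longrightarrow> h x = x"
      using orthogonal_transformation_reflection[of "g u" u'] u(1) u'(1)
        orthogonal_transformation_norm[OF g(1)] by metis
    have fixed: "h x = x" if x: "x \<in> F' k" for x
    proof -
      obtain y where "y \<in> F k" "x = g y"
        using g(2)[of k] x by blast
      then have "g u \<bullet> x = 0"
        using u(2) g(1) by (simp add: orthogonal_transformation_def)
      then show ?thesis
        using h(3) u'(2) x by blast
    qed
    have lower: "(h \<circ> g) ` F j = F' j" if "j \<le> k" for j
    proof -
      have "F' j \<subseteq> F' k"
        using flag_mono[OF F' that] Suc.prems by simp
      then have "h ` F' j = F' j"
        using fixed by (force simp: image_iff)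
      then show ?thesis
        using g(2)[OF that] by (simp only: image_comp[symmetric])
    qed
    have hg: "orthogonal_transformation (h \<circ> g)"
      using h(1) g(1) by (rule orthogonal_transformation_compose)
    have "(h \<circ> g) ` F (Suc k) = span ((h \<circ> g) ` insert u (F k))"
      unfolding u(3) using orthogonal_transformation_linear[OF hg]
      by (rule linear_span_image[symmetric])
    also have "\<dots> = F' (Suc k)"
      using lower[of k] h(2) u'(3) by simp
    finally show ?case
      using lower hg by (metis le_SucE)
  qed
  from this[OF order_refl] obtain g where g: "orthogonal_transformation g" "\<forall>j\<le>CARD('n). g ` F j = F' j"
    by blast
  \<comment> \<open>Above n both sides are \<open>undefined\<close> by extensionality, so the flags
    are equal as functions.\<close>
  have "flag_action g F k = F' k" for k
    using g(2) flag_undefined[OF F', of k] by (cases "k \<le> CARD('n)") (auto simp: flag_action_def)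
  then show ?thesis
    using g that by blast
qed

text \<open>Injective linear maps are allowed, and not just orthogonal ones, because the existence
  proof moves a flag by arbitrary invertible matrices.\<close>

lemma flag_action_in_flags:
  assumes F: "F \<in> (flags :: (nat \<Rightarrow> (real ^ 'n) set) set)" and g: "linear g" "inj g"
  shows "flag_action g F \<in> flags"
proof -
  have "dim (g ` F k) = k" if "k \<le> CARD('n)" for k
    using dim_image_eq[OF g(1) inj_on_subset[OF g(2)]] dim_flag[OF F that] by simp
  moreover have "subspace (g ` F k)" if "k \<le> CARD('n)" for k
    using linear_subspace_image[OF g(1) subspace_flag[OF F that]] .
  moreover have "g ` F k \<subseteq> g ` F (Suc k)" if "k < CARD('n)" for k
    using flag_mono[OF F, of k "Suc k"] that by (intro image_mono) simp
  ultimately show ?thesis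
    by (auto simp: flags_def flag_action_def)
qed

lemma flag_action_orthogonal_in_flags:
  assumes "F \<in> (flags :: (nat \<Rightarrow> (real ^ 'n) set) set)" "orthogonal_transformation g"
  shows "flag_action g F \<in> flags"
  using assms by (intro flag_action_in_flags orthogonal_transformation_linear orthogonal_transformation_inj)

lemma flag_action_compose:
  "flag_action g (flag_action h F) = flag_action (\<lambda>x. g (h x)) F"
  by (simp add: flag_action_def image_image fun_eq_iff restrict_def)

lemma flag_action_id:
  assumes "F \<in> (flags :: (nat \<Rightarrow> (real ^ 'n) set) set)"
  shows "flag_action (\<lambda>x. x) F = F"
  using flag_undefined[OF assms] by (simp add: flag_action_def fun_eq_iff restrict_def)

lemma flag_action_inv:
  assumes F: "F \<in> (flags :: (nat \<Rightarrow> (real ^ 'n) set) set)" and g: "orthogonal_transformation g"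
  shows "flag_action (inv g) (flag_action g F) = F" "flag_action g (flag_action (inv g) F) = F"
  using flag_action_id[OF F] orthogonal_transformation_inj[OF g] orthogonal_transformation_surj[OF g]
  by (simp_all add: flag_action_compose surj_f_inv_f)

text \<open>Invariance is defined through images, measurability through preimages; this passes from
  one to the other.\<close>

lemma flag_action_image_eq:
  assumes E: "E \<subseteq> (flags :: (nat \<Rightarrow> (real ^ 'n) set) set)" and g: "orthogonal_transformation g"
  shows "flag_action g ` E = {F \<in> flags. flag_action (inv g) F \<in> E}"
proof (intro equalityI subsetI)
  fix F assume "F \<in> flag_action g ` E"
  then obtain F0 where "F0 \<in> E" "F = flag_action g F0" by blast
  then show "F \<in> {F \<in> flags. flag_action (inv g) F \<in> E}"
    using E flag_action_inv(1)[OF _ g, of F0] flag_action_orthogonal_in_flags[OF _ g, of F0] by auto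
next
  fix F assume "F \<in> {F \<in> flags. flag_action (inv g) F \<in> E}"
  then show "F \<in> flag_action g ` E"
    using flag_action_inv(2)[OF _ g, of F] by (metis (mono_tags, lifting) image_eqI mem_Collect_eq)
qed

section \<open>Borel structure and invariant distance on the flag manifold\<close>

text \<open>The Borel sigma-algebra of the flag manifold, named separately so that measurability can
  be discussed before an invariant measure is known to exist.\<close>

definition flag_algebra :: "(nat \<Rightarrow> (real ^ 'n) set) measure" where
  "flag_algebra = sigma flags {U. openin flag_topology U}"

lemma openin_flag_topology:
  "openin flag_topology U \<longleftrightarrow>
    (\<exists>V. open V \<and> U = (\<lambda>F k. matrix (closest_point (F k)) :: real ^ 'n ^ 'n) -` V \<inter> flags)"
  by (simp add: flag_topology_def openin_pullback_topology)

lemma open_flags_subset: "{U. openin flag_topology U} \<subseteq> Pow (flags :: (nat \<Rightarrow> (real ^ 'n) set) set)"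
  by (auto simp: openin_flag_topology)

lemma space_flag_algebra [simp]: "space flag_algebra = flags"
  by (simp add: flag_algebra_def space_measure_of_conv)

lemma sets_flag_algebra: "sets flag_algebra = sigma_sets flags {U. openin flag_topology U}"
  by (simp add: flag_algebra_def open_flags_subset)

text \<open>The topology is pulled back from a countable product of second countable spaces, where
  the Borel sets are generated by the coordinates. Coordinates above n are constant on
  flags.\<close>

lemma measurable_into_flag_algebra:
  fixes f :: "'a \<Rightarrow> nat \<Rightarrow> (real ^ 'n) set"
  assumes f: "\<And>x. x \<in> space N \<Longrightarrow> f x \<in> flags"
    and meas: "\<And>k. k \<le> CARD('n) \<Longrightarrow> (\<lambda>x. matrix (closest_point (f x k))) \<in> borel_measurable N"
  shows "f \<in> measurable N flag_algebra"
proof (rule measurable_sigma_sets[OF sets_flag_algebra open_flags_subset])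
  have "(\<lambda>x. matrix (closest_point (f x k))) \<in> borel_measurable N" for k
  proof (cases "k \<le> CARD('n)")
    case False
    then have "(\<lambda>x. matrix (closest_point (f x k))) \<in> borel_measurable N \<longleftrightarrow>
        (\<lambda>x. matrix (closest_point (undefined :: (real ^ 'n) set))) \<in> borel_measurable N"
      using f by (intro measurable_cong) (simp add: flag_undefined)
    then show ?thesis by simp
  qed (rule meas)
  then have m: "(\<lambda>x k. matrix (closest_point (f x k))) \<in> borel_measurable N"
    by (rule measurable_coordinatewise_then_product)
  fix U :: "(nat \<Rightarrow> (real ^ 'n) set) set"
  assume "U \<in> {U. openin flag_topology U}"
  then obtain V where V: "open V" and U: "U = (\<lambda>F k. matrix (closest_point (F k)) :: real ^ 'n ^ 'n) -` V \<inter> flags"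
    by (auto simp: openin_flag_topology)
  have "f -` U \<inter> space N = (\<lambda>x k. matrix (closest_point (f x k)) :: real ^ 'n ^ 'n) -` V \<inter> space N"
    using f by (auto simp: U)
  then show "f -` U \<inter> space N \<in> sets N"
    using measurable_sets[OF m, of V] V by simp
qed (use f in auto)

lemma measurable_flag_projection [measurable]:
  "(\<lambda>F. matrix (closest_point (F k)) :: real ^ 'n ^ 'n) \<in> borel_measurable flag_algebra"
proof (rule borel_measurableI)
  fix S :: "(real ^ 'n ^ 'n) set" assume S: "open S"
  have "open ((\<lambda>x. x k) -` S)"
    using continuous_open_vimage[OF S, of "\<lambda>x. x k"] continuous_on_product_coordinates[of k]
    by (metis S open_vimage)
  then have "openin flag_topology ((\<lambda>F k. matrix (closest_point (F k)) :: real ^ 'n ^ 'n) -` ((\<lambda>x. x k) -` S) \<inter> flags)"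
    unfolding openin_flag_topology by blast
  moreover have "(\<lambda>F. matrix (closest_point (F k)) :: real ^ 'n ^ 'n) -` S \<inter> space flag_algebra =
      (\<lambda>F k. matrix (closest_point (F k)) :: real ^ 'n ^ 'n) -` ((\<lambda>x. x k) -` S) \<inter> flags"
    by auto
  ultimately show "(\<lambda>F. matrix (closest_point (F k)) :: real ^ 'n ^ 'n) -` S \<inter> space flag_algebra \<in> sets flag_algebra"
    unfolding sets_flag_algebra by (auto intro: sigma_sets.Basic)
qed

text \<open>The product metric on sequences of matrices would not be O(n)-invariant; this sum of Frobenius
  distances is.\<close>

definition flag_dist :: "(nat \<Rightarrow> (real ^ 'n) set) \<Rightarrow> (nat \<Rightarrow> (real ^ 'n) set) \<Rightarrow> real" where
  "flag_dist F G = (\<Sum>k\<le>CARD('n). dist (matrix (closest_point (F k))) (matrix (closest_point (G k))))"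

lemma flag_dist_commute: "flag_dist F G = flag_dist G F"
  by (simp add: flag_dist_def dist_commute)

lemma flag_dist_orthogonal:
  assumes "F \<in> (flags :: (nat \<Rightarrow> (real ^ 'n) set) set)" "G \<in> flags" "orthogonal_transformation g"
  shows "flag_dist (flag_action g F) (flag_action g G) = flag_dist F G"
  using assms by (auto simp: flag_dist_def flag_action_def subspace_flag
      intro!: sum.cong dist_matrix_closest_point_orthogonal_image)

lemma measurable_flag_dist:
  "(\<lambda>p. flag_dist (fst p) (snd p)) \<in>
    borel_measurable (flag_algebra \<Otimes>\<^sub>M (flag_algebra :: (nat \<Rightarrow> (real ^ 'n) set) measure))"
  unfolding flag_dist_def by measurable

lemma flag_dist_ball_subset_open:
  assumes U: "openin flag_topology (U :: (nat \<Rightarrow> (real ^ 'n) set) set)" and F: "F \<in> U"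
  shows "\<exists>r>0. {G \<in> flags. flag_dist F G < r} \<subseteq> U"
proof -
  let ?P = "\<lambda>F k. matrix (closest_point (F k)) :: real ^ 'n ^ 'n"
  obtain V where V: "open V" and U: "U = ?P -` V \<inter> flags"
    using U by (auto simp: openin_flag_topology)
  have "openin (product_topology (\<lambda>i. euclidean) UNIV) V" "?P F \<in> V"
    using V F U by (auto simp: open_fun_def)
  from product_topology_open_contains_basis[OF this]
  obtain X where X: "\<And>k. ?P F k \<in> X k" "\<And>k. open (X k)" "Pi\<^sub>E UNIV X \<subseteq> V"
    by (auto simp: PiE_iff)
  have "\<exists>e>0. ball (?P F k) e \<subseteq> X k" for k
    using X by (simp add: open_contains_ball_eq)
  then obtain e where e: "\<And>k. e k > 0" "\<And>k. ball (?P F k) (e k) \<subseteq> X k"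
    by metis
  \<comment> \<open>All flags agree above n, so only the levels up to n constrain the radius, and a
    minimum over finitely many positive numbers is positive.\<close>
  define r where "r = Min (e ` {..CARD('n)})"
  have "r > 0"
    using e(1) by (simp add: r_def)
  moreover have "G \<in> U" if G: "G \<in> flags" "flag_dist F G < r" for G
  proof -
    have "?P G k \<in> X k" for k
    proof (cases "k \<le> CARD('n)")
      case True
      have "dist (?P F k) (?P G k) \<le> flag_dist F G"
        unfolding flag_dist_def using True by (intro member_le_sum) auto
      also have "\<dots> < r" by fact
      also have "r \<le> e k" using True by (simp add: r_def)
      finally show ?thesis using e(2)[of k] by (auto simp: ball_def)
    next
      case False
      then have "?P G k = ?P F k"
        using G F U by (simp add: flag_undefined)
      then show ?thesis using X(1)[of k] by simp
    qed
    then show ?thesis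
      using X(3) G(1) by (auto simp: U PiE_iff subset_iff)
  qed
  ultimately show ?thesis by blast
qed

text \<open>The ball about \<open>F\<close> is the trace on flags of the open set \<open>B F\<close>
  of matrix sequences, and the space of such sequences is Lindelof.\<close>

lemma flags_covered_by_countably_many_balls:
  assumes "0 < r"
  obtains C where "countable C" "C \<subseteq> (flags :: (nat \<Rightarrow> (real ^ 'n) set) set)"
    "flags = (\<Union>F\<in>C. {G \<in> flags. flag_dist F G < r})"
proof -
  let ?P = "\<lambda>F k. matrix (closest_point (F k)) :: real ^ 'n ^ 'n"
  define B where "B F = {y. (\<Sum>k\<le>CARD('n). dist (?P F k) (y k)) < r}" for F
  have B: "open (B F)" for F
    unfolding B_def
    by (intro open_Collect_less continuous_intros continuous_on_product_coordinates)
  obtain \<F> where \<F>: "\<F> \<subseteq> B ` flags" "countable \<F>" "\<Union>\<F> = \<Union>(B ` flags)"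
    using Lindelof[of "B ` flags"] B by (metis imageE)
  obtain C where C: "countable C" "C \<subseteq> flags" "\<F> = B ` C"
    using \<F>(1,2) countable_subset_image[of \<F> B flags] by auto
  have "\<exists>F\<in>C. flag_dist F G < r" if "G \<in> flags" for G
  proof -
    have "?P G \<in> B G"
      using assms by (simp add: B_def)
    then have "?P G \<in> \<Union>(B ` C)"
      using \<F>(3) that C(3) by auto
    then show ?thesis
      by (auto simp: B_def flag_dist_def)
  qed
  then show ?thesis
    using that[OF C(1,2)] C(2) by auto
qed

subsection \<open>The invariant measure on flags\<close>

lemma rbracket_pos: "0 < m \<Longrightarrow> 0 < rbracket m"
  by (simp add: rbracket_def)

lemma rfact_pos: "0 < rfact m"
  unfolding rfact_def by (intro prod_pos) (simp add: rbracket_pos)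

context
  fixes M :: "(nat \<Rightarrow> (real ^ 'n) set) measure"
  assumes M: "is_invariant_flag_measure M"
begin

lemma
  shows space_invariant_flag_measure: "space M = flags"
    and sets_invariant_flag_measure: "sets M = sets flag_algebra"
    and finite_invariant_flag_measure: "finite_measure M"
    and emeasure_invariant_flag_measure_flags: "emeasure M flags = ennreal (rfact CARD('n))"
  using M by (auto simp: is_invariant_flag_measure_def sets_flag_algebra intro!: finite_measureI)

lemma sets_flag_ball: "{G \<in> flags. flag_dist F G < r} \<in> sets M" if F: "F \<in> flags"
proof -
  have "flag_dist F \<in> borel_measurable flag_algebra"
    unfolding flag_dist_def by measurable
  then have "{G \<in> space flag_algebra. flag_dist F G < r} \<in> sets flag_algebra"
    by measurable
  then show ?thesis
    by (simp add: sets_invariant_flag_measure)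
qed

text \<open>An orthogonal map carrying \<open>F\<close> to \<open>F'\<close> preserves the distance,
  so it carries the ball about \<open>F\<close> onto the ball about \<open>F'\<close>, and it
  preserves \<open>M\<close>.\<close>

lemma emeasure_flag_ball_cong:
  assumes F: "F \<in> flags" and F': "F' \<in> flags"
  shows "emeasure M {G \<in> flags. flag_dist F G < r} = emeasure M {G \<in> flags. flag_dist F' G < r}"
proof -
  obtain g where g: "orthogonal_transformation g" "flag_action g F = F'"
    using flags_transitive[OF F F'] .
  have "flag_dist F (flag_action (inv g) G) = flag_dist F' G" if "G \<in> flags" for G
    using flag_dist_orthogonal[OF F' that orthogonal_transformation_inv[OF g(1)]]
      flag_action_inv(1)[OF F g(1)] g(2) by simp
  then have "flag_action g ` {G \<in> flags. flag_dist F G < r} = {G \<in> flags. flag_dist F' G < r}"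
    using flag_action_orthogonal_in_flags[OF _ orthogonal_transformation_inv[OF g(1)]]
    by (subst flag_action_image_eq[OF _ g(1)]) auto
  moreover have "emeasure M (flag_action g ` {G \<in> flags. flag_dist F G < r}) =
      emeasure M {G \<in> flags. flag_dist F G < r}"
    using M g(1) sets_flag_ball[OF F] by (simp add: is_invariant_flag_measure_def)
  ultimately show ?thesis by simp
qed

text \<open>If one ball were null, all balls of that radius would be, and countably many of them
  cover \<open>flags\<close>, whose mass is positive.\<close>

lemma emeasure_flag_ball_pos:
  assumes F: "F \<in> flags" and r: "0 < r"
  shows "0 < emeasure M {G \<in> flags. flag_dist F G < r}"
proof (rule ccontr)
  assume "\<not> ?thesis"
  then have null: "{G \<in> flags. flag_dist F' G < r} \<in> null_sets M" if "F' \<in> flags" for F'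
    using emeasure_flag_ball_cong[OF that F] sets_flag_ball[OF that] by (auto simp: null_sets_def)
  obtain C :: "(nat \<Rightarrow> (real ^ 'n) set) set"
    where C: "countable C" "C \<subseteq> flags" "flags = (\<Union>F\<in>C. {G \<in> flags. flag_dist F G < r})"
    by (rule flags_covered_by_countably_many_balls[OF r])
  have "flags \<in> null_sets M"
    using null_sets_UN'[of C "\<lambda>F. {G \<in> flags. flag_dist F G < r}" M] C(1,2) null
    by (subst C(3)) blast
  then show False
    using emeasure_invariant_flag_measure_flags rfact_pos[of "CARD('n)"] by (auto simp: null_sets_def)
qed

end

lemma invariant_flag_measure_unique:
  assumes M: "is_invariant_flag_measure (M :: (nat \<Rightarrow> (real ^ 'n) set) measure)"
    and N: "is_invariant_flag_measure N"
  shows "M = N"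
proof -
  interpret M: finite_measure M using finite_invariant_flag_measure[OF M] .
  interpret N: finite_measure N using finite_invariant_flag_measure[OF N] .
  interpret MN: pair_sigma_finite M N ..
  obtain F0 :: "nat \<Rightarrow> (real ^ 'n) set" where F0: "F0 \<in> flags"
    using flags_nonempty by blast
  note sp = space_invariant_flag_measure[OF M] space_invariant_flag_measure[OF N]
  note st = sets_invariant_flag_measure[OF M] sets_invariant_flag_measure[OF N]
  define h where "h r = emeasure M {G \<in> flags. flag_dist F0 G < r}" for r
  define m where "m = ennreal (rfact CARD('n))"
  have m: "0 < m" "m < \<infinity>"
    by (simp_all add: m_def rfact_pos)
  note tot = emeasure_invariant_flag_measure_flags[OF M, folded m_def]
    emeasure_invariant_flag_measure_flags[OF N, folded m_def]
  have hM: "emeasure M {G \<in> flags. flag_dist F G < r} = h r" if "F \<in> flags" for F r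
    unfolding h_def by (rule emeasure_flag_ball_cong[OF M that F0])
  have hN: "emeasure N {G \<in> flags. flag_dist F G < r} = h r" if F: "F \<in> flags" for F r
  proof -
    \<comment> \<open>Christensen's theorem needs the same ball function \<open>h\<close> for both
      measures. The product mass of the pairs at distance below r, computed in either order, is the
      ball mass of one measure times the common total mass \<open>m\<close>; since \<open>m\<close>
      is positive and finite it cancels.\<close>
    define B where "B = {p \<in> space (M \<Otimes>\<^sub>M N). flag_dist (fst p) (snd p) < r}"
    have "(\<lambda>p. flag_dist (fst p) (snd p)) \<in> borel_measurable (M \<Otimes>\<^sub>M N)"
      using measurable_flag_dist[where 'n='n] st
        measurable_cong_sets[OF sets_pair_measure_cong[OF st] refl] by blast
    then have B: "B \<in> sets (M \<Otimes>\<^sub>M N)"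
      unfolding B_def by measurable
    have "emeasure (M \<Otimes>\<^sub>M N) B = (\<integral>\<^sup>+ x. emeasure N (Pair x -` B) \<partial>M)"
      by (rule N.emeasure_pair_measure_alt[OF B])
    also have "\<dots> = (\<integral>\<^sup>+ x. emeasure N {G \<in> flags. flag_dist F G < r} \<partial>M)"
    proof (rule nn_integral_cong)
      fix x assume x: "x \<in> space M"
      then have "Pair x -` B = {G \<in> flags. flag_dist x G < r}"
        by (auto simp: B_def space_pair_measure sp)
      then show "emeasure N (Pair x -` B) = emeasure N {G \<in> flags. flag_dist F G < r}"
        using emeasure_flag_ball_cong[OF N _ F, of x r] x by (simp add: sp)
    qed
    also have "\<dots> = emeasure N {G \<in> flags. flag_dist F G < r} * m"
      by (simp add: sp tot)
    finally have 1: "emeasure (M \<Otimes>\<^sub>M N) B = emeasure N {G \<in> flags. flag_dist F G < r} * m" .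
    have "emeasure (M \<Otimes>\<^sub>M N) B = (\<integral>\<^sup>+ y. emeasure M ((\<lambda>x. (x, y)) -` B) \<partial>N)"
      by (rule MN.emeasure_pair_measure_alt2[OF B])
    also have "\<dots> = (\<integral>\<^sup>+ y. h r \<partial>N)"
    proof (rule nn_integral_cong)
      fix y assume y: "y \<in> space N"
      then have "(\<lambda>x. (x, y)) -` B = {G \<in> flags. flag_dist y G < r}"
        by (auto simp: B_def space_pair_measure sp flag_dist_commute)
      then show "emeasure M ((\<lambda>x. (x, y)) -` B) = h r"
        using hM y by (simp add: sp)
    qed
    also have "\<dots> = h r * m"
      by (simp add: sp tot)
    finally have "emeasure N {G \<in> flags. flag_dist F G < r} * m / m = h r * m / m"
      using 1 by simp
    then show ?thesis
      using m by (simp add: ennreal_mult_divide_eq less_top)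
  qed
  show ?thesis
  proof (rule uniformly_distributed_unique[where D = flag_dist and h = h and \<Omega> = flags
        and E = "{U. openin flag_topology U}" and A = "\<lambda>_. flags"])
    show "sigma_finite_measure M" "sigma_finite_measure N"
      by unfold_locales
    show "(\<lambda>p. flag_dist (fst p) (snd p)) \<in> borel_measurable (M \<Otimes>\<^sub>M M)"
      using measurable_flag_dist[where 'n='n]
        measurable_cong_sets[OF sets_pair_measure_cong[OF st(1) st(1)] refl] by blast
    show "flag_dist F G = flag_dist G F" for F G :: "nat \<Rightarrow> (real ^ 'n) set"
      by (rule flag_dist_commute)
    show "0 < h r \<and> h r < \<infinity>" if "0 < r" for r
      using emeasure_flag_ball_pos[OF M F0 that] M.emeasure_finite by (simp add: h_def less_top[symmetric])
    show "Int_stable {U. openin flag_topology (U :: (nat \<Rightarrow> (real ^ 'n) set) set)}"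
      by (auto simp: Int_stable_def openin_Int)
    show "range (\<lambda>_::nat. flags) \<subseteq> {U. openin flag_topology (U :: (nat \<Rightarrow> (real ^ 'n) set) set)}"
      by (auto simp: openin_flag_topology intro!: exI[of _ UNIV])
    show "emeasure M {G \<in> space M. flag_dist F G < r} = h r"
      "emeasure N {G \<in> space M. flag_dist F G < r} = h r" if "F \<in> space M" for F r
      using hM hN that by (simp_all add: sp)
    show "\<exists>r>0. {G \<in> space M. flag_dist F G < r} \<subseteq> U" if "U \<in> {U. openin flag_topology U}" "F \<in> U" for U F
      using flag_dist_ball_subset_open[of U F] that by (simp add: sp)
    show "sets M = sigma_sets flags {U. openin flag_topology U}"
      "sets N = sigma_sets flags {U. openin flag_topology U}"
      using st by (simp_all add: sets_flag_algebra)
    show "{U. openin flag_topology U} \<subseteq> Pow (flags :: (nat \<Rightarrow> (real ^ 'n) set) set)"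
      by (rule open_flags_subset)
    show "(\<Union>i::nat. flags) = (flags :: (nat \<Rightarrow> (real ^ 'n) set) set)"
      by simp
    show "emeasure M flags \<noteq> \<infinity>"
      by simp
  qed
qed

section \<open>Existence of the invariant measure\<close>

text \<open>Gram-Schmidt for projections: one more level adds the rank-one term v v^T / (v . v),
  where v is the component of \<open>A *v u\<close> orthogonal to the image of the previous level.
  The formula also holds for singular \<open>A\<close>, where v may vanish and the quotient is 0, so
  the map is Borel on all matrices although it need not be continuous.\<close>

lemma measurable_matrix_closest_point_image_flag:
  fixes F :: "nat \<Rightarrow> (real ^ 'n) set"
  assumes F: "F \<in> flags" and "k \<le> CARD('n)"
  shows "(\<lambda>A. matrix (closest_point ((*v) A ` F k)) :: real ^ 'n ^ 'n) \<in> borel_measurable (borel :: (real ^ 'n ^ 'n) measure)"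
  using assms(2)
proof (induction k)
  case 0
  show ?case by (simp add: flag_0[OF F])
next
  case (Suc k)
  obtain u where u: "F (Suc k) = span (insert u (F k))"
    using flag_step[OF F, of k] Suc.prems by (metis Suc_le_lessD)
  define P where "P A = (matrix (closest_point ((*v) A ` F k)) :: real ^ 'n ^ 'n)" for A :: "real ^ 'n ^ 'n"
  define v where "v A = A *v u - P A *v (A *v u)" for A
  have [measurable]: "P \<in> borel_measurable borel"
    unfolding P_def using Suc by simp
  have cont: "continuous_on UNIV (\<lambda>p :: (real ^ 'n ^ 'n) \<times> (real ^ 'n). fst p *v snd p)"
    unfolding matrix_vector_mult_def by (intro continuous_intros)
  have mv: "(\<lambda>x. f x *v w x) \<in> borel_measurable N"
    if "f \<in> borel_measurable N" "w \<in> borel_measurable N"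
    for f :: "'z \<Rightarrow> real ^ 'n ^ 'n" and w and N :: "'z measure"
    using borel_measurable_continuous_Pair[OF that cont] by simp
  have v: "v \<in> borel_measurable borel"
    unfolding v_def by (intro borel_measurable_diff mv) auto
  have outer: "(\<lambda>v :: real ^ 'n. (\<chi> i j. v $ i * v $ j) :: real ^ 'n ^ 'n) \<in> borel_measurable borel"
    by (intro borel_measurable_continuous_onI continuous_intros)
  have "matrix (closest_point ((*v) A ` F (Suc k))) =
      P A + (1 / (v A \<bullet> v A)) *\<^sub>R (\<chi> i j. v A $ i * v A $ j)" for A
  proof -
    have S: "subspace ((*v) A ` F k)"
      using subspace_flag[OF F, of k] Suc.prems by (intro linear_subspace_image) auto
    have img: "(*v) A ` F (Suc k) = span (insert (A *v u) ((*v) A ` F k))"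
      unfolding u by (subst linear_span_image[symmetric]) auto
    have cp: "closest_point ((*v) A ` F k) x = P A *v x" for x
      using linear_closest_point_subspace[OF S] by (simp add: P_def matrix_works)
    have "closest_point ((*v) A ` F (Suc k)) x =
        (P A + (1 / (v A \<bullet> v A)) *\<^sub>R (\<chi> i j. v A $ i * v A $ j)) *v x" for x
    proof -
      have "(\<chi> i j. v A $ i * v A $ j) *v x = (v A \<bullet> x) *\<^sub>R v A"
        by (simp add: vec_eq_iff matrix_vector_mult_def inner_vec_def sum_distrib_left mult_ac)
      then show ?thesis
        using closest_point_span_insert[OF S, of "v A" "A *v u" x] unfolding img cp
        by (simp add: v_def matrix_vector_mult_add_rdistrib scaleR_matrix_vector_assoc[symmetric])
    qed
    then have "closest_point ((*v) A ` F (Suc k)) =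
        (*v) (P A + (1 / (v A \<bullet> v A)) *\<^sub>R (\<chi> i j. v A $ i * v A $ j))" by blast
    then show ?thesis by simp
  qed
  moreover have "(\<lambda>A. P A + (1 / (v A \<bullet> v A)) *\<^sub>R (\<chi> i j. v A $ i * v A $ j)) \<in> borel_measurable borel"
    using v measurable_compose[OF v outer] by measurable
  ultimately show ?case by simp
qed

lemma measurable_flag_action:
  assumes g: "orthogonal_transformation g"
  shows "flag_action g \<in> measurable flag_algebra (flag_algebra :: (nat \<Rightarrow> (real ^ 'n) set) measure)"
proof (rule measurable_into_flag_algebra)
  fix k assume k: "k \<le> CARD('n)"
  have "continuous_on UNIV (\<lambda>X :: real ^ 'n ^ 'n. matrix g ** X ** transpose (matrix g))"
    unfolding matrix_matrix_mult_def by (intro continuous_intros)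
  then have "(\<lambda>F. matrix g ** matrix (closest_point (F k)) ** transpose (matrix g)) \<in> borel_measurable flag_algebra"
    using measurable_compose[OF measurable_flag_projection borel_measurable_continuous_onI] by blast
  then show "(\<lambda>F. matrix (closest_point (flag_action g F k)) :: real ^ 'n ^ 'n) \<in> borel_measurable flag_algebra"
    by (rule measurable_cong[THEN iffD1, rotated])
      (use k g in \<open>simp add: flag_action_def matrix_closest_point_orthogonal_image subspace_flag\<close>)
qed (use g flag_action_orthogonal_in_flags in auto)

lemma invariant_flag_measure_exists:
  "\<exists>M :: (nat \<Rightarrow> (real ^ 'n) set) measure. is_invariant_flag_measure M"
proof -
  obtain F0 :: "nat \<Rightarrow> (real ^ 'n) set" where F0: "F0 \<in> flags"
    using flags_nonempty by blast
  text \<open>The invertible matrices in a ball, under Lebesgue measure, are invariant under left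
    multiplication by O(n); their orbit map at F0 pushes this measure to an invariant one.\<close>
  define S where "S = {A :: real ^ 'n ^ 'n. det A \<noteq> 0} \<inter> ball 0 (norm (mat 1 :: real ^ 'n ^ 'n) + 1)"
  have "open {A :: real ^ 'n ^ 'n. det A \<noteq> 0}"
    unfolding det_def by (intro open_Collect_neq continuous_intros)
  then have "open S"
    by (auto simp: S_def)
  then have S[measurable]: "S \<in> sets lborel"
    by simp
  \<comment> \<open>The radius of the ball in \<open>S\<close> is chosen so as to include the
    identity; as \<open>S\<close> is open, its mass is then positive.\<close>
  have "mat 1 \<in> S"
    by (simp add: S_def)
  then obtain e where e: "e > 0" "ball (mat 1) e \<subseteq> S"
    using \<open>open S\<close> by (meson open_contains_ball)
  define s where "s = emeasure lborel S"
  have "0 < emeasure lborel (ball (mat 1 :: real ^ 'n ^ 'n) e)"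
    using e(1) by (simp add: emeasure_ball)
  also have "\<dots> \<le> s"
    unfolding s_def using e(2) S by (rule emeasure_mono)
  finally have s0: "0 < s" .
  have "s \<le> emeasure lborel (ball (0 :: real ^ 'n ^ 'n) (norm (mat 1 :: real ^ 'n ^ 'n) + 1))"
    unfolding s_def by (intro emeasure_mono) (auto simp: S_def)
  also have "\<dots> < \<infinity>"
    by (rule emeasure_lborel_ball_finite)
  finally have s1: "s < \<infinity>" .
  define \<Psi> where "\<Psi> A = flag_action ((*v) A) F0" for A
  define N where "N = restrict_space lborel S"
  have space_N: "space N = S"
    by (simp add: N_def space_restrict_space)
  have \<Psi>_flag: "\<Psi> A \<in> flags" if "A \<in> S" for A
    unfolding \<Psi>_def using that
    by (intro flag_action_in_flags F0 inj_matrix_vector_mult) (auto simp: S_def invertible_det_nz)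
  have \<Psi>[measurable]: "\<Psi> \<in> measurable N flag_algebra"
  proof (rule measurable_into_flag_algebra)
    fix k assume k: "k \<le> CARD('n)"
    then show "(\<lambda>A. matrix (closest_point (\<Psi> A k))) \<in> borel_measurable N"
      using measurable_matrix_closest_point_image_flag[OF F0 k]
      by (simp add: N_def \<Psi>_def flag_action_def measurable_restrict_space1)
  qed (use \<Psi>_flag space_N in auto)
  define M0 where "M0 = distr N flag_algebra \<Psi>"
  have M0: "emeasure M0 E = emeasure lborel {A \<in> S. \<Psi> A \<in> E}" and E_meas: "{A \<in> S. \<Psi> A \<in> E} \<in> sets lborel"
    if E: "E \<in> sets flag_algebra" for E
  proof -
    have eq: "\<Psi> -` E \<inter> space N = {A \<in> S. \<Psi> A \<in> E}"
      by (auto simp: space_N)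
    have "emeasure M0 E = emeasure N {A \<in> S. \<Psi> A \<in> E}"
      unfolding M0_def using emeasure_distr[OF \<Psi> E] eq by simp
    also have "\<dots> = emeasure lborel {A \<in> S. \<Psi> A \<in> E}"
      unfolding N_def using S by (intro emeasure_restrict_space) auto
    finally show "emeasure M0 E = emeasure lborel {A \<in> S. \<Psi> A \<in> E}" .
    have "\<Psi> -` E \<inter> space N \<in> sets N"
      using \<Psi> E by (rule measurable_sets)
    then show "{A \<in> S. \<Psi> A \<in> E} \<in> sets lborel"
      unfolding eq using S by (simp add: N_def sets_restrict_space_iff)
  qed
  have inv: "emeasure M0 (flag_action g ` E) = emeasure M0 E"
    if g: "orthogonal_transformation g" and E: "E \<in> sets flag_algebra" for g E
  proof -
    have g': "orthogonal_transformation (inv g)"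
      using g by (rule orthogonal_transformation_inv)
    \<comment> \<open>The inverse appears because the image of \<open>E\<close> under
      \<open>g\<close> is the preimage of \<open>E\<close> under \<open>inv g\<close>.\<close>
    define G where "G = matrix (inv g)"
    have G: "orthogonal_matrix G" and lin: "linear (inv g)"
      using g' by (simp_all add: G_def orthogonal_transformation_matrix)
    have Gv: "inv g x = G *v x" for x
      using lin by (simp add: G_def)
    have sub: "E \<subseteq> flags"
      using sets.sets_into_space[OF E] by simp
    have gE: "flag_action g ` E \<in> sets flag_algebra"
      unfolding flag_action_image_eq[OF sub g]
      using measurable_sets[OF measurable_flag_action[OF g'] E] by (simp add: vimage_def Int_def conj_commute)
    have L: "orthogonal_transformation (\<lambda>A :: real ^ 'n ^ 'n. G ** A)"
      unfolding orthogonal_transformation using norm_orthogonal_matrix_mult[OF G]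
      by (auto intro!: linearI simp: matrix_add_ldistrib matrix_scalar_ac
          matrix_eq matrix_vector_mul_assoc[symmetric] scaleR_matrix_vector_assoc[symmetric]
          matrix_vector_mult_scaleR)
    have detG: "det G \<noteq> 0"
      using G det_orthogonal_matrix by fastforce
    \<comment> \<open>Nonvanishing of the determinant and the Frobenius norm are both preserved, so
      \<open>S\<close> is stable under left multiplication by \<open>G\<close>.\<close>
    have S_iff: "G ** A \<in> S \<longleftrightarrow> A \<in> S" for A
      using detG norm_orthogonal_matrix_mult[OF G, of A] by (simp add: S_def det_mul)
    have \<Psi>_G: "\<Psi> (G ** A) = flag_action (inv g) (\<Psi> A)" for A
      by (simp add: \<Psi>_def flag_action_compose Gv matrix_vector_mul_assoc)
    have "{A \<in> S. \<Psi> A \<in> flag_action g ` E} = (\<lambda>A. G ** A) -` {A \<in> S. \<Psi> A \<in> E} \<inter> space lborel"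
      using \<Psi>_flag by (auto simp: flag_action_image_eq[OF sub g] S_iff \<Psi>_G)
    also have "emeasure lborel \<dots> = emeasure (distr lborel borel (\<lambda>A. G ** A)) {A \<in> S. \<Psi> A \<in> E}"
      using E_meas[OF E] orthogonal_transformation_linear[OF L]
      by (subst emeasure_distr)
        (auto intro!: borel_measurable_continuous_onI linear_continuous_on simp: linear_linear)
    also have "\<dots> = emeasure lborel {A \<in> S. \<Psi> A \<in> E}"
      by (simp add: lborel_distr_orthogonal_transformation[OF L])
    finally show ?thesis
      by (simp add: M0 gE E)
  qed
  define M where "M = scale_measure (ennreal (rfact CARD('n)) / s) M0"
  have "{A \<in> S. \<Psi> A \<in> flags} = S"
    using \<Psi>_flag by blast
  then have "emeasure M0 flags = s"
    using M0[of flags] sets.top[of "flag_algebra :: (nat \<Rightarrow> (real ^ 'n) set) measure"] by (simp add: s_def)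
  then have "emeasure M flags = ennreal (rfact CARD('n))"
    using s0 s1 by (simp add: M_def ennreal_divide_times less_top[symmetric])
  then have "is_invariant_flag_measure M"
    using inv by (auto simp: is_invariant_flag_measure_def M_def M0_def space_scale_measure sets_flag_algebra)
  then show ?thesis by blast
qed

lemma is_invariant_flag_measure_The:
  "is_invariant_flag_measure (THE M :: (nat \<Rightarrow> (real ^ 'n) set) measure. is_invariant_flag_measure M)"
  by (rule theI', rule ex_ex1I[OF invariant_flag_measure_exists invariant_flag_measure_unique])

subsection \<open>Counting compositions through a flag\<close>

text \<open>\<open>flags\<close> is a Borel set, so passing to the completion keeps its
  mass.\<close>

lemma
  shows space_flag_measure: "space (flag_measure :: (nat \<Rightarrow> (real ^ 'n) set) measure) = flags"
    and emeasure_flag_measure_flags: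
      "emeasure flag_measure (flags :: (nat \<Rightarrow> (real ^ 'n) set) set) = ennreal (rfact CARD('n))"
    and finite_flag_measure: "finite_measure (flag_measure :: (nat \<Rightarrow> (real ^ 'n) set) measure)"
proof -
  let ?M = "THE M :: (nat \<Rightarrow> (real ^ 'n) set) measure. is_invariant_flag_measure M"
  have "space ?M = flags" "emeasure ?M flags = ennreal (rfact CARD('n))"
    using is_invariant_flag_measure_The[where 'n='n] by (auto simp: is_invariant_flag_measure_def)
  moreover from this have "flags \<in> sets ?M"
    using sets.top[of ?M] by simp
  ultimately show "space (flag_measure :: (nat \<Rightarrow> (real ^ 'n) set) measure) = flags"
    and "emeasure flag_measure (flags :: (nat \<Rightarrow> (real ^ 'n) set) set) = ennreal (rfact CARD('n))"
    by (simp_all add: flag_measure_def)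
  then show "finite_measure (flag_measure :: (nat \<Rightarrow> (real ^ 'n) set) measure)"
    by (intro finite_measureI) simp
qed

lemma measure_flag_measure_flags:
  "measure flag_measure (flags :: (nat \<Rightarrow> (real ^ 'n) set) set) = rfact CARD('n)"
  using emeasure_flag_measure_flags[where 'n='n] rfact_pos[of "CARD('n)"] by (simp add: measure_def)

lemma finite_compositions: "finite (compositions n k)"
proof (rule finite_subset)
  show "compositions n k \<subseteq> {xs. set xs \<subseteq> {..n} \<and> length xs = k}"
    by (auto simp: compositions_def intro: member_le_sum_list)
qed (simp add: finite_lists_length_eq)

lemma multiflag_coeff_pos: "0 < multiflag_coeff a"
proof -
  have "0 < (\<Prod>x\<leftarrow>a. rfact x)"
    by (induction a) (simp_all add: rfact_pos)
  then show ?thesis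
    by (simp add: multiflag_coeff_def rfact_pos)
qed

text \<open>The last part of \<open>a\<close> is what \<open>butlast a\<close> leaves of n, so both
  denominators are the same product of factorials. What remains is the probability that a random
  flag passes through a chain of the family.\<close>

lemma chain_measure_eq_multiflag_coeff:
  fixes \<E> :: "(real ^ 'n) set list set"
  assumes a: "a \<in> compositions CARD('n) (r + 1)"
  shows "chain_measure (butlast a) \<E> =
    measure flag_measure (flags_through (butlast a) \<E>) / rfact CARD('n) * multiflag_coeff a"
proof -
  have "a \<noteq> []" and sum: "sum_list a = CARD('n)"
    using a by (auto simp: compositions_def)
  then obtain as x where ax: "a = as @ [x]"
    by (metis append_butlast_last_id)
  then have "CARD('n) - sum_list as = x"
    using sum by simp
  then show ?thesis
    using rfact_pos[of "CARD('n)"] sum ax by (simp add: chain_measure_def multiflag_coeff_def)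
qed

text \<open>The partial sums for k = 0 and k = r + 1 are 0 and n in any case, and the parts are the
  consecutive differences. The sums with k in \<open>{1..r}\<close> are the dimensions of the
  members of an r-chain.\<close>

lemma inj_on_partial_sums:
  "inj_on (\<lambda>a. \<lambda>k\<in>{1..r}. sum_list (take k a)) (compositions n (r + 1))"
proof (rule inj_onI)
  fix a b
  assume a: "a \<in> compositions n (r + 1)" and b: "b \<in> compositions n (r + 1)"
    and eq: "(\<lambda>k\<in>{1..r}. sum_list (take k a)) = (\<lambda>k\<in>{1..r}. sum_list (take k b))"
  have len: "length a = r + 1" "length b = r + 1" and "sum_list a = n" "sum_list b = n"
    using a b by (auto simp: compositions_def)
  have ps: "sum_list (take k a) = sum_list (take k b)" if "k \<le> r + 1" for k
  proof (cases "k \<in> {1..r}")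
    case True
    then show ?thesis using fun_cong[OF eq, of k] by simp
  next
    case False
    then have "k = 0 \<or> k = r + 1" using that by auto
    then show ?thesis
      using len \<open>sum_list a = n\<close> \<open>sum_list b = n\<close> by auto
  qed
  show "a = b"
  proof (rule nth_equalityI)
    fix i assume "i < length a"
    then show "a ! i = b ! i"
      using ps[of i] ps[of "Suc i"] len by (simp add: take_Suc_conv_app_nth)
  qed (simp add: len)
qed

text \<open>\<open>chain_free\<close> excludes only chains with exactly t + 1 members, but any
  larger chain contains one of that size.\<close>

lemma chain_free_card_le:
  assumes X: "finite X" "X \<subseteq> \<A>" "\<And>U V. U \<in> X \<Longrightarrow> V \<in> X \<Longrightarrow> U \<subseteq> V \<or> V \<subseteq> U"
    and "chain_free t \<A>"
  shows "card X \<le> t"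
proof (rule ccontr)
  assume "\<not> card X \<le> t"
  then obtain K where "K \<subseteq> X" "card K = t + 1"
    using obtain_subset_with_card_n[of "t + 1" X] by auto
  then show False
    using assms unfolding chain_free_def by (meson subset_iff subset_trans)
qed

lemma card_compositions_through_flag_le:
  fixes \<C> :: "(real ^ 'n) set list set"
  assumes F: "F \<in> flags"
    and free: "\<And>k. k \<in> {1..r} \<Longrightarrow> chain_free (t k) (component k \<C>)"
  shows "card {a \<in> compositions CARD('n) (r + 1). F \<in> flags_through (butlast a) (of_type \<C> (butlast a))}
    \<le> (\<Prod>k=1..r. t k)" (is "card ?K \<le> _")
proof -
  \<comment> \<open>The levels of \<open>F\<close> are recorded by their dimensions instead of as
    subspaces; \<open>F\<close> is injective on them because \<open>dim (F j) = j\<close>. The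
    partial sums of an admissible composition then lie in the product of these sets.\<close>
  define X where "X k = {j. j \<le> CARD('n) \<and> F j \<in> component k \<C>}" for k
  have card_X: "card (X k) \<le> t k" if k: "k \<in> {1..r}" for k
  proof -
    have "card (F ` X k) \<le> t k"
    proof (rule chain_free_card_le[OF _ _ _ free[OF k]])
      show "F ` X k \<subseteq> component k \<C>" by (auto simp: X_def)
      show "U \<subseteq> V \<or> V \<subseteq> U" if UV: "U \<in> F ` X k" "V \<in> F ` X k" for U V
      proof -
        obtain i j where "i \<le> CARD('n)" "j \<le> CARD('n)" "U = F i" "V = F j"
          using UV by (auto simp: X_def)
        then show ?thesis
          using flag_mono[OF F, of i j] flag_mono[OF F, of j i] by (metis nat_le_linear)
      qed
    qed (simp add: X_def)
    moreover have "inj_on F (X k)"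
      using dim_flag[OF F] by (intro inj_onI) (metis (mono_tags, lifting) X_def mem_Collect_eq)
    ultimately show ?thesis by (simp add: card_image)
  qed
  let ?s = "\<lambda>a. \<lambda>k\<in>{1..r}. sum_list (take k a)"
  have "?s ` ?K \<subseteq> Pi\<^sub>E {1..r} X"
  proof (clarsimp simp: PiE_iff)
    fix a k
    assume a: "a \<in> compositions CARD('n) (Suc r)" and k: "Suc 0 \<le> k" "k \<le> r"
      and "F \<in> flags_through (butlast a) (of_type \<C> (butlast a))"
    then obtain cs where cs: "cs \<in> \<C>" "compatible (butlast a) F cs"
      by (auto simp: flags_through_def of_type_def)
    have len: "length a = Suc r" "sum_list a = CARD('n)"
      using a by (auto simp: compositions_def)
    \<comment> \<open>As k is at most r, dropping the last of the r + 1 parts leaves the first k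
      unchanged.\<close>
    then have "F (sum_list (take k a)) = cs ! (k - 1)"
      using cs(2) k by (auto simp: compatible_def take_butlast)
    then have "F (sum_list (take k a)) \<in> component k \<C>"
      using cs(1) by (simp add: component_def)
    moreover have "sum_list (take k a) \<le> CARD('n)"
      using len(2) by (metis append_take_drop_id le_add1 sum_list_append)
    ultimately show "sum_list (take k a) \<in> X k"
      by (simp add: X_def)
  qed
  moreover have "finite (Pi\<^sub>E {1..r} X)"
    by (intro finite_PiE) (auto simp: X_def)
  moreover have "inj_on ?s ?K"
    by (rule inj_on_subset[OF inj_on_partial_sums]) blast
  ultimately have "card ?K \<le> card (Pi\<^sub>E {1..r} X)"
    by (metis (no_types, lifting) card_image card_mono)
  also have "\<dots> = (\<Prod>k=1..r. card (X k))"
    by (simp add: card_PiE)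
  also have "\<dots> \<le> (\<Prod>k=1..r. t k)"
    using card_X by (intro prod_mono) auto
  finally show ?thesis .
qed

section \<open>Expected multiplicity, linear optimisation and the two bounds\<close>

text \<open>The left side is the integral of the function that counts the sets \<open>E a\<close>
  containing x.\<close>

lemma sum_measure_le_of_multiplicity_le:
  assumes "finite_measure M" and "finite A" and "\<And>a. a \<in> A \<Longrightarrow> E a \<in> sets M"
    and mult: "\<And>x. x \<in> space M \<Longrightarrow> card {a \<in> A. x \<in> E a} \<le> m"
  shows "(\<Sum>a\<in>A. measure M (E a)) \<le> real m * measure M (space M)"
proof -
  interpret finite_measure M by fact
  have "(\<Sum>a\<in>A. measure M (E a)) = (\<integral>x. (\<Sum>a\<in>A. indicat_real (E a) x) \<partial>M)"
    using assms(2,3) by (subst Bochner_Integration.integral_sum) (auto simp: integrable_indicator_iff less_top[symmetric])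
  also have "\<dots> \<le> (\<integral>x. real m \<partial>M)"
  proof (rule integral_mono)
    show "integrable M (\<lambda>x. \<Sum>a\<in>A. indicat_real (E a) x)"
      using assms(3) by (intro Bochner_Integration.integrable_sum) (auto simp: integrable_indicator_iff less_top[symmetric])
    fix x assume "x \<in> space M"
    have "(\<Sum>a\<in>A. indicat_real (E a) x) = real (card {a \<in> A. x \<in> E a})"
      using assms(2) by (simp add: indicator_def sum.If_cases Int_def)
    then show "(\<Sum>a\<in>A. indicat_real (E a) x) \<le> real m"
      using mult[OF \<open>x \<in> space M\<close>] by simp
  qed simp
  finally show ?thesis by (simp add: mult.commute)
qed

text \<open>Fractional knapsack: shifting the weight outside the m best indices into the room left
  inside them cannot decrease the sum, since a threshold \<theta> separates the two groups of
  values.\<close>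

lemma weighted_sum_le_sum_largest:
  fixes w c :: "'a \<Rightarrow> real"
  assumes A: "finite A" and w: "\<And>a. a \<in> A \<Longrightarrow> 0 \<le> w a" "\<And>a. a \<in> A \<Longrightarrow> w a \<le> 1"
    and c: "\<And>a. a \<in> A \<Longrightarrow> 0 \<le> c a" and sum: "(\<Sum>a\<in>A. w a) \<le> real m"
  shows "(\<Sum>a\<in>A. w a * c a) \<le>
    sum_list (take m (rev (sorted_list_of_multiset (image_mset c (mset_set A)))))"
proof -
  obtain xs where xs: "set xs = A" "distinct xs"
    using finite_distinct_list[OF A] by blast
  \<comment> \<open>Indices are sorted instead of values, so that the largest coefficients, ties
    included, belong to a definite set of indices.\<close>
  define ys where "ys = rev (sort_key c xs)"
  have ys: "set ys = A" "distinct ys" "sorted (rev (map c ys))"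
    by (simp_all add: ys_def xs rev_map)
  have "image_mset c (mset_set A) = mset (rev (map c ys))"
    using ys by (simp add: mset_set_set[symmetric])
  then have "rev (sorted_list_of_multiset (image_mset c (mset_set A))) = map c ys"
    using ys(3) by (simp add: sorted_sort_id del: mset_rev)
  then have "sum_list (take m (rev (sorted_list_of_multiset (image_mset c (mset_set A))))) =
      (\<Sum>a\<leftarrow>take m ys. c a)"
    by (simp add: take_map)
  also have "\<dots> = sum c (set (take m ys))"
    using ys(2) by (simp add: sum_list_distinct_conv_sum_set)
  also have "(\<Sum>a\<in>A. w a * c a) \<le> sum c (set (take m ys))"
  proof (cases "m < length ys")
    case False
    then show ?thesis
      using ys(1) w c by (auto intro!: sum_mono mult_left_le_one_le)
  next
    case True
    define B where "B = set (take m ys)"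
    have B: "B \<subseteq> A" "card B = m"
      using ys True set_take_subset[of m ys] by (auto simp: B_def distinct_card)
    have split: "(\<Sum>a\<in>A. f a) = (\<Sum>a\<in>B. f a) + (\<Sum>a\<in>A-B. f a)" for f :: "'a \<Rightarrow> real"
      using sum.subset_diff[OF B(1) A, of f] by simp
    \<comment> \<open>Positions start at 0, so this is the largest value outside
      \<open>B\<close>.\<close>
    define \<theta> where "\<theta> = c (ys ! m)"
    have desc: "c (ys ! j) \<le> c (ys ! i)" if "i \<le> j" "j < length ys" for i j
      using sorted_rev_nth_mono[OF ys(3) that(1)] that by simp
    have "0 \<le> \<theta>"
      using c ys(1) True by (auto simp: \<theta>_def)
    have upper: "\<theta> \<le> c a" if a: "a \<in> B" for a
    proof -
      obtain i where "i < m" "a = ys ! i"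
        using a by (auto simp: B_def in_set_conv_nth)
      then show ?thesis using desc[of i m] True by (simp add: \<theta>_def)
    qed
    have lower: "c a \<le> \<theta>" if a: "a \<in> A - B" for a
    proof -
      have "a \<in> set (drop m ys)"
        using a ys(1) append_take_drop_id[of m ys] unfolding B_def by (metis DiffE UnE set_append)
      then obtain i where "i < length ys - m" "a = ys ! (m + i)"
        using True by (auto simp: in_set_conv_nth)
      then show ?thesis using desc[of m "m + i"] by (simp add: \<theta>_def)
    qed
    have "(\<Sum>a\<in>A-B. w a * c a) \<le> (\<Sum>a\<in>A-B. w a * \<theta>)"
      using w lower by (intro sum_mono mult_left_mono) auto
    also have "\<dots> = \<theta> * (\<Sum>a\<in>A-B. w a)"
      by (simp add: sum_distrib_left mult.commute)
    \<comment> \<open>Since \<open>card B = m\<close>, the bound m on the total weight leaves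
      outside \<open>B\<close> at most what is missing inside \<open>B\<close>.\<close>
    also have "\<dots> \<le> \<theta> * (\<Sum>a\<in>B. 1 - w a)"
      using sum split[of w] B(2) \<open>0 \<le> \<theta>\<close> by (intro mult_left_mono) (simp_all add: sum_subtractf)
    also have "\<dots> = (\<Sum>a\<in>B. \<theta> * (1 - w a))"
      by (rule sum_distrib_left)
    also have "\<dots> \<le> (\<Sum>a\<in>B. c a * (1 - w a))"
      using w B(1) upper by (intro sum_mono mult_right_mono) auto
    also have "\<dots> = sum c B - (\<Sum>a\<in>B. w a * c a)"
      by (simp add: right_diff_distrib sum_subtractf mult.commute)
    finally show ?thesis
      using split[of "\<lambda>a. w a * c a"] by (simp add: B_def)
  qed
  finally show ?thesis .
qed

theorem theorem5p2:
  fixes \<C> :: "(real ^ 'n) set list set"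
    and r \<tau> :: nat
    and t :: "nat \<Rightarrow> nat"
  assumes "r \<ge> 1"
    and "\<And>k. k \<in> {1..r} \<Longrightarrow> t k \<ge> 1"
    and "\<tau> = (\<Prod>k=1..r. t k)"
    and "\<C> \<subseteq> rchains r"
    and "measurable_family r \<C>"
    and "\<And>k. k \<in> {1..r} \<Longrightarrow> chain_free (t k) (component k \<C>)"
  shows "(\<Sum>a\<in>compositions CARD('n) (r + 1).
            chain_measure (butlast a) (of_type \<C> (butlast a)) / multiflag_coeff a) \<le> real \<tau>
         \<and> family_measure r \<C> \<le> sum_list (largest_coeffs \<tau> CARD('n) (r + 1))"
proof -
  interpret finite_measure "flag_measure :: (nat \<Rightarrow> (real ^ 'n) set) measure"
    by (rule finite_flag_measure)
  define E where "E a = flags_through (butlast a) (of_type \<C> (butlast a))" for a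
  \<comment> \<open>For the normalised flag measure, \<open>w a\<close> is the probability of the
    event \<open>E a\<close>; these are the weights of the optimisation.\<close>
  define w where "w a = measure flag_measure (E a) / rfact CARD('n)" for a
  let ?A = "compositions CARD('n) (r + 1)"
  have chain: "chain_measure (butlast a) (of_type \<C> (butlast a)) = w a * multiflag_coeff a" if "a \<in> ?A" for a
    using chain_measure_eq_multiflag_coeff[OF that] by (simp add: w_def E_def)
  have E: "E a \<in> sets flag_measure" if a: "a \<in> ?A" for a
  proof -
    have "a \<noteq> []" using a by (auto simp: compositions_def)
    \<comment> \<open>Index tuples must have sum strictly below n, which holds because the removed
      last part is positive.\<close>
    then have "sum_list a = sum_list (butlast a) + last a"
      by (metis append_butlast_last_id sum_list.Cons sum_list.Nil sum_list_append add.right_neutral)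
    moreover have "0 < last a" "\<forall>x\<in>set (butlast a). 0 < x"
      using a \<open>a \<noteq> []\<close> by (auto simp: compositions_def dest: in_set_butlastD)
    ultimately have "butlast a \<in> index_tuples CARD('n) r"
      using a by (auto simp: compositions_def index_tuples_def)
    then show ?thesis
      using assms(5) by (simp add: measurable_family_def E_def)
  qed
  have "(\<Sum>a\<in>?A. measure flag_measure (E a)) \<le> real \<tau> * measure flag_measure (space (flag_measure :: (nat \<Rightarrow> (real ^ 'n) set) measure))"
    using card_compositions_through_flag_le[OF _ assms(6)] E assms(3)
    by (intro sum_measure_le_of_multiplicity_le finite_measure_axioms finite_compositions)
      (auto simp: space_flag_measure E_def)
  then have sum_w: "(\<Sum>a\<in>?A. w a) \<le> real \<tau>"
    using rfact_pos[of "CARD('n)"]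
    by (simp add: w_def sum_divide_distrib[symmetric] space_flag_measure measure_flag_measure_flags divide_le_eq)
  have w: "0 \<le> w a" "w a \<le> 1" for a
    using bounded_measure[of "E a"] rfact_pos[of "CARD('n)"]
    by (simp_all add: w_def space_flag_measure measure_flag_measure_flags less_imp_le)
  have "(\<Sum>a\<in>?A. chain_measure (butlast a) (of_type \<C> (butlast a)) / multiflag_coeff a) = (\<Sum>a\<in>?A. w a)"
    using multiflag_coeff_pos by (intro sum.cong refl) (simp add: chain less_imp_neq[symmetric])
  moreover have "family_measure r \<C> = (\<Sum>a\<in>?A. w a * multiflag_coeff a)"
    unfolding family_measure_def using chain by (intro sum.cong refl)
  ultimately show ?thesis
    using weighted_sum_le_sum_largest[OF finite_compositions w _ sum_w, of multiflag_coeff]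
      sum_w multiflag_coeff_pos by (simp add: largest_coeffs_def less_imp_le)
qed

end
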